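(* Let $R$ be a commutative ring, and let $\theta$ be a partition. In $\Lambda_R$, the products $$s_\alpha s_\beta,\qquad \{\alpha,\beta\}\in\operatorname{Split}(\theta),$$ are linearly independent over $R$ (one product for each unordered pair $\{\alpha,\beta\}\in\operatorname{Split}(\theta)$).
   Context: $\Lambda_{\mathbb{Z}}$ is the ring of symmetric functions over $\mathbb{Z}$ in infinitely many variables, and $\Lambda_R=R\otimes_{\mathbb{Z}}\Lambda_{\mathbb{Z}}$. $s_\lambda$ denotes the Schur function of the partition $\lambda$. Partitions are padded with trailing zeros when needed, and $\alpha+\beta$ denotes the componentwise sum $(\alpha_1+\beta_1,\alpha_2+\beta_2,\ldots)$. A $\theta$-splitting is an unordered pair $\{\alpha,\beta\}$ of (possibly empty, possibly equal) partitions such that $\alpha+\beta=\theta$ componentwise, and $\operatorname{Split}(\theta)$ is the set of all $\theta$-splittings. *)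

theory Defs
  imports "HOL-Library.Multiset" "HOL-Library.Poly_Mapping" "HOL-Combinatorics.Permutations"
begin

section \<open>The ring of symmetric functions over the integers\<close>

text \<open>
  Monomials in the variables \<open>x\<^sub>0, x\<^sub>1, \<dots>\<close> are finitely supported exponent functions, with the
  monoid operation written additively. A formal power series is the function sending a monomial to
  its coefficient.
\<close>

type_synonym monomial = "nat \<Rightarrow>\<^sub>0 nat"

definition monomial_deg :: "monomial \<Rightarrow> nat" where
  "monomial_deg m = (\<Sum>i\<in>Poly_Mapping.keys m. Poly_Mapping.lookup m i)"

text \<open>The monomial \<open>Poly_Mapping.map_key \<pi> m\<close> has exponent sequence \<open>m \<circ> \<pi>\<close>.\<close>

definition symmetric_series :: "(monomial \<Rightarrow> int) \<Rightarrow> bool" where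
  "symmetric_series f \<longleftrightarrow> (\<forall>\<pi> m. bij \<pi> \<longrightarrow> f (Poly_Mapping.map_key \<pi> m) = f m)"

definition bounded_degree :: "(monomial \<Rightarrow> int) \<Rightarrow> bool" where
  "bounded_degree f \<longleftrightarrow> (\<exists>d. \<forall>m. f m \<noteq> 0 \<longrightarrow> monomial_deg m \<le> d)"

definition splits :: "monomial \<Rightarrow> (monomial \<times> monomial) set" where
  "splits m = {(p, q). p + q = m}"

lemma monomial_deg_add: "monomial_deg (p + q) = monomial_deg p + monomial_deg q"
  unfolding monomial_deg_def by (rule setsum_keys_plus_distrib) auto

lemma monomial_deg_superset:
  assumes "finite S" "Poly_Mapping.keys m \<subseteq> S"
  shows "monomial_deg m = sum (Poly_Mapping.lookup m) S"
  unfolding monomial_deg_def using assms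
  by (intro sum.mono_neutral_left) (auto simp: in_keys_iff)

lemma finite_splits: "finite (splits m)"
proof -
  let ?K = "Poly_Mapping.keys m" and ?B = "{..monomial_deg m}"
  let ?F = "{f. \<forall>x. (x \<in> ?K \<longrightarrow> f x \<in> ?B) \<and> (x \<notin> ?K \<longrightarrow> f x = (0::nat))}"
  let ?S = "{p. \<exists>q. p + q = m}"
  have le: "Poly_Mapping.lookup m x \<le> monomial_deg m" for x
  proof (cases "x \<in> ?K")
    case True
    thus ?thesis unfolding monomial_deg_def by (intro member_le_sum) simp_all
  qed (simp add: in_keys_iff)
  have "Poly_Mapping.lookup ` ?S \<subseteq> ?F"
  proof (rule image_subsetI)
    fix p assume "p \<in> ?S"
    then obtain q where m: "m = p + q" by auto
    have a: "Poly_Mapping.lookup p x \<le> Poly_Mapping.lookup m x" for x by (simp add: m lookup_add)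
    have "Poly_Mapping.lookup p x \<le> monomial_deg m" for x using le_trans[OF a le] .
    moreover have "Poly_Mapping.lookup p x = 0" if "x \<notin> ?K" for x
      using that a[of x] by (simp add: in_keys_iff)
    ultimately show "Poly_Mapping.lookup p \<in> ?F" by auto
  qed
  moreover have "finite ?F" by (rule finite_set_of_finite_funs) auto
  ultimately have "finite (Poly_Mapping.lookup ` ?S)" by (rule finite_subset)
  hence f: "finite ?S" by (rule finite_imageD) (simp add: inj_on_def)
  have "splits m \<subseteq> ?S \<times> ?S"
  proof
    fix x assume "x \<in> splits m"
    hence "fst x + snd x = m" "snd x + fst x = m" by (auto simp: splits_def add.commute)
    thus "x \<in> ?S \<times> ?S" by (cases x) auto
  qed
  thus ?thesis by (rule finite_subset) (simp add: f)
qed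

lemma splits_iff: "(p, q) \<in> splits m \<longleftrightarrow> p + q = m"
  by (simp add: splits_def)

lemma map_key_bij_inv:
  assumes "bij \<pi>"
  shows "Poly_Mapping.map_key (inv \<pi>) (Poly_Mapping.map_key \<pi> m) = m"
    "Poly_Mapping.map_key \<pi> (Poly_Mapping.map_key (inv \<pi>) m) = m"
proof -
  have "inj \<pi>" "inj (inv \<pi>)" "surj \<pi>" using assms by (auto simp: bij_is_inj bij_is_surj bij_imp_bij_inv)
  thus "Poly_Mapping.map_key (inv \<pi>) (Poly_Mapping.map_key \<pi> m) = m"
    "Poly_Mapping.map_key \<pi> (Poly_Mapping.map_key (inv \<pi>) m) = m"
    by (auto intro!: poly_mapping_eqI simp: map_key.rep_eq surj_f_inv_f inv_f_f)
qed

typedef symm_fun = "{f :: monomial \<Rightarrow> int. symmetric_series f \<and> bounded_degree f}"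
  morphisms sf_coeff Abs_symm_fun
  by (rule exI[of _ "\<lambda>_. 0"]) (simp add: symmetric_series_def bounded_degree_def)

setup_lifting type_definition_symm_fun

instantiation symm_fun :: comm_ring_1
begin

lift_definition zero_symm_fun :: symm_fun is "\<lambda>_. 0"
  by (simp add: symmetric_series_def bounded_degree_def)

lift_definition one_symm_fun :: symm_fun is "\<lambda>m. if m = 0 then 1 else 0"
proof -
  have "(Poly_Mapping.map_key \<pi> m = 0) = (m = 0)" if "bij \<pi>" for \<pi> :: "nat \<Rightarrow> nat" and m :: monomial
    using map_key_bij_inv(1)[OF that, of m] that
    by (metis bij_imp_bij_inv bij_is_inj map_key_zero)
  thus "symmetric_series (\<lambda>m. if m = 0 then 1 else 0) \<and> bounded_degree (\<lambda>m. if m = 0 then 1 else 0)"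
    by (auto simp: symmetric_series_def bounded_degree_def monomial_deg_def)
qed

lift_definition uminus_symm_fun :: "symm_fun \<Rightarrow> symm_fun" is "\<lambda>f m. - f m"
  by (simp add: symmetric_series_def bounded_degree_def)

lift_definition plus_symm_fun :: "symm_fun \<Rightarrow> symm_fun \<Rightarrow> symm_fun" is "\<lambda>f g m. f m + g m"
proof -
  fix f g :: "monomial \<Rightarrow> int"
  assume f: "symmetric_series f \<and> bounded_degree f" and g: "symmetric_series g \<and> bounded_degree g"
  then obtain d e where d: "\<And>m. f m \<noteq> 0 \<Longrightarrow> monomial_deg m \<le> d" "\<And>m. g m \<noteq> 0 \<Longrightarrow> monomial_deg m \<le> e"
    by (auto simp: bounded_degree_def)
  have "monomial_deg m \<le> max d e" if "f m + g m \<noteq> 0" for m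
    using d(1)[of m] d(2)[of m] that by linarith
  hence "bounded_degree (\<lambda>m. f m + g m)" by (auto simp: bounded_degree_def)
  thus "symmetric_series (\<lambda>m. f m + g m) \<and> bounded_degree (\<lambda>m. f m + g m)"
    using f g by (simp add: symmetric_series_def)
qed

lift_definition minus_symm_fun :: "symm_fun \<Rightarrow> symm_fun \<Rightarrow> symm_fun" is "\<lambda>f g m. f m - g m"
proof -
  fix f g :: "monomial \<Rightarrow> int"
  assume f: "symmetric_series f \<and> bounded_degree f" and g: "symmetric_series g \<and> bounded_degree g"
  then obtain d e where d: "\<And>m. f m \<noteq> 0 \<Longrightarrow> monomial_deg m \<le> d" "\<And>m. g m \<noteq> 0 \<Longrightarrow> monomial_deg m \<le> e"
    by (auto simp: bounded_degree_def)
  have "monomial_deg m \<le> max d e" if "f m - g m \<noteq> 0" for m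
    using d(1)[of m] d(2)[of m] that by linarith
  hence "bounded_degree (\<lambda>m. f m - g m)" by (auto simp: bounded_degree_def)
  thus "symmetric_series (\<lambda>m. f m - g m) \<and> bounded_degree (\<lambda>m. f m - g m)"
    using f g by (simp add: symmetric_series_def)
qed

lift_definition times_symm_fun :: "symm_fun \<Rightarrow> symm_fun \<Rightarrow> symm_fun"
  is "\<lambda>f g m. \<Sum>(p, q)\<in>splits m. f p * g q"
proof -
  fix f g :: "monomial \<Rightarrow> int"
  assume f: "symmetric_series f \<and> bounded_degree f" and g: "symmetric_series g \<and> bounded_degree g"
  then obtain d e where d: "\<And>m. f m \<noteq> 0 \<Longrightarrow> monomial_deg m \<le> d" "\<And>m. g m \<noteq> 0 \<Longrightarrow> monomial_deg m \<le> e"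
    by (auto simp: bounded_degree_def)
  have "monomial_deg m \<le> d + e" if nz: "(\<Sum>(p, q)\<in>splits m. f p * g q) \<noteq> 0" for m
  proof -
    obtain x where x: "x \<in> splits m" "(case x of (p, q) \<Rightarrow> f p * g q) \<noteq> 0"
      using nz sum.not_neutral_contains_not_neutral by blast
    obtain p q where "x = (p, q)" by force
    hence "p + q = m" "f p \<noteq> 0" "g q \<noteq> 0" using x by (auto simp: splits_def)
    thus ?thesis using d(1)[of p] d(2)[of q] monomial_deg_add[of p q] by simp
  qed
  hence b: "bounded_degree (\<lambda>m. \<Sum>(p, q)\<in>splits m. f p * g q)" by (auto simp: bounded_degree_def)
  have "symmetric_series (\<lambda>m. \<Sum>(p, q)\<in>splits m. f p * g q)"
    unfolding symmetric_series_def
  proof (intro allI impI)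
    fix \<pi> :: "nat \<Rightarrow> nat" and m :: monomial assume \<pi>: "bij \<pi>"
    have i: "inj \<pi>" "inj (inv \<pi>)" using \<pi> by (auto simp: bij_is_inj bij_imp_bij_inv)
    let ?k = "\<lambda>\<pi> (p :: monomial, q :: monomial). (Poly_Mapping.map_key \<pi> p, Poly_Mapping.map_key \<pi> q)"
    have fi: "f (Poly_Mapping.map_key \<pi> p) = f p" "g (Poly_Mapping.map_key \<pi> p) = g p"
      "f (Poly_Mapping.map_key (inv \<pi>) p) = f p" "g (Poly_Mapping.map_key (inv \<pi>) p) = g p" for p
      using f g \<pi> bij_imp_bij_inv[OF \<pi>] by (auto simp: symmetric_series_def)
    show "(\<Sum>(p, q)\<in>splits (Poly_Mapping.map_key \<pi> m). f p * g q) = (\<Sum>(p, q)\<in>splits m. f p * g q)"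
      by (rule sum.reindex_bij_witness[of _ "?k \<pi>" "?k (inv \<pi>)"])
        (auto simp: splits_def map_key_bij_inv[OF \<pi>] fi simp flip: map_key_plus[OF i(1)] map_key_plus[OF i(2)])
  qed
  thus "symmetric_series (\<lambda>m. \<Sum>(p, q)\<in>splits m. f p * g q) \<and> bounded_degree (\<lambda>m. \<Sum>(p, q)\<in>splits m. f p * g q)"
    using b by simp
qed

instance
proof
  fix a b c :: symm_fun
  show "a * b = b * a"
  proof (transfer, rule ext)
    fix f g :: "monomial \<Rightarrow> int" and m
    show "(\<Sum>(p, q)\<in>splits m. f p * g q) = (\<Sum>(p, q)\<in>splits m. g p * f q)"
      by (rule sum.reindex_bij_witness[of _ prod.swap prod.swap])
        (auto simp: splits_def add.commute mult.commute)
  qed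
  show "a * b * c = a * (b * c)"
  proof (transfer, rule ext)
    fix f g h :: "monomial \<Rightarrow> int" and m
    have "(\<Sum>(p, q)\<in>splits m. (\<Sum>(p', q')\<in>splits p. f p' * g q') * h q)
        = (\<Sum>x\<in>splits m. \<Sum>y\<in>splits (fst x). f (fst y) * g (snd y) * h (snd x))"
      by (simp add: split_beta sum_distrib_right)
    also have "\<dots> = (\<Sum>(x, y)\<in>Sigma (splits m) (\<lambda>x. splits (fst x)). f (fst y) * g (snd y) * h (snd x))"
      by (rule sum.Sigma) (auto simp: finite_splits)
    also have "\<dots> = (\<Sum>(x, y)\<in>Sigma (splits m) (\<lambda>x. splits (snd x)). f (fst x) * (g (fst y) * h (snd y)))"
      by (rule sum.reindex_bij_witness[of _
          "\<lambda>(x, y). ((fst x + fst y, snd y), (fst x, fst y))"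
          "\<lambda>(x, y). ((fst y, snd y + snd x), (snd y, snd x))"])
        (auto simp: splits_def add.assoc mult.assoc)
    also have "\<dots> = (\<Sum>x\<in>splits m. \<Sum>y\<in>splits (snd x). f (fst x) * (g (fst y) * h (snd y)))"
      by (rule sum.Sigma[symmetric]) (auto simp: finite_splits)
    also have "\<dots> = (\<Sum>(p, q)\<in>splits m. f p * (\<Sum>(p', q')\<in>splits q. g p' * h q'))"
      by (simp add: split_beta sum_distrib_left)
    finally show "(\<Sum>(p, q)\<in>splits m. (\<Sum>(p', q')\<in>splits p. f p' * g q') * h q)
      = (\<Sum>(p, q)\<in>splits m. f p * (\<Sum>(p', q')\<in>splits q. g p' * h q'))" .
  qed
  show "1 * a = a"
  proof (transfer, rule ext)
    fix f :: "monomial \<Rightarrow> int" and m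
    have "(\<Sum>(p, q)\<in>splits m. (if p = 0 then 1 else 0) * f q) = (\<Sum>(p, q)\<in>{(0 :: monomial, m)}. (if p = 0 then 1 else 0) * f q)"
      by (rule sum.mono_neutral_right) (auto simp: finite_splits splits_iff split: if_splits)
    thus "(\<Sum>(p, q)\<in>splits m. (if p = 0 then 1 else 0) * f q) = f m" by simp
  qed
  show "(a + b) * c = a * c + b * c"
    by (transfer, rule ext) (simp add: split_beta distrib_right sum.distrib)
  show "(0::symm_fun) \<noteq> 1" by transfer (auto simp: fun_eq_iff)
qed (transfer; simp add: fun_eq_iff)+

end

section \<open>Tensor products of commutative rings over the integers\<close>

text \<open>
  The sort \<open>{comm_ring, comm_monoid_mult}\<close> is the sort of all commutative unital rings; unlike
  \<open>comm_ring_1\<close>, it does not exclude the zero ring.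

  The tensor product \<open>A \<otimes> B\<close> over the integers is the free abelian group on \<open>A \<times> B\<close> modulo the
  bilinearity relations. The free abelian group is the monoid ring of the multiplicative monoid
  \<open>A \<times> B\<close>, which explains the multiplication. As \<open>\<Rightarrow>\<^sub>0\<close> expects its key monoid in additive notation,
  the pairs are wrapped in a type of their own.
\<close>

datatype ('a, 'b) tensor_key = Key 'a 'b

instantiation tensor_key :: (comm_monoid_mult, comm_monoid_mult) comm_monoid_add
begin

definition zero_tensor_key :: "('a, 'b) tensor_key" where
  "zero_tensor_key = Key 1 1"

fun plus_tensor_key :: "('a, 'b) tensor_key \<Rightarrow> ('a, 'b) tensor_key \<Rightarrow> ('a, 'b) tensor_key" where
  "plus_tensor_key (Key a b) (Key c d) = Key (a * c) (b * d)"

instance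
proof
  fix x y z :: "('a, 'b) tensor_key"
  show "x + y + z = x + (y + z)" by (cases x; cases y; cases z) (simp add: mult.assoc)
  show "x + y = y + x" by (cases x; cases y) (simp add: mult.commute)
  show "0 + x = x" by (cases x) (simp add: zero_tensor_key_def)
qed

end

inductive_set tensor_relations ::
  "(('a::{comm_ring,comm_monoid_mult}, 'b::{comm_ring,comm_monoid_mult}) tensor_key \<Rightarrow>\<^sub>0 int) set"
where
  zero: "0 \<in> tensor_relations"
| diff: "x \<in> tensor_relations \<Longrightarrow> y \<in> tensor_relations \<Longrightarrow> x - y \<in> tensor_relations"
| left: "frag_of (Key (a + a') b) - frag_of (Key a b) - frag_of (Key a' b) \<in> tensor_relations"
| right: "frag_of (Key a (b + b')) - frag_of (Key a b) - frag_of (Key a b') \<in> tensor_relations"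

lemma tensor_relations_uminus: "x \<in> tensor_relations \<Longrightarrow> - x \<in> tensor_relations"
  using tensor_relations.diff[OF tensor_relations.zero] by fastforce

lemma tensor_relations_add:
  "x \<in> tensor_relations \<Longrightarrow> y \<in> tensor_relations \<Longrightarrow> x + y \<in> tensor_relations"
  using tensor_relations.diff[OF _ tensor_relations_uminus] by fastforce

lemma frag_of_Key_mult: "frag_of (Key a b) * frag_of (Key c d) = frag_of (Key (a * c) (b * d))"
  by (simp add: mult_single)

lemma tensor_relations_mult_frag_of:
  "x \<in> tensor_relations \<Longrightarrow> x * frag_of k \<in> tensor_relations"
proof (induction rule: tensor_relations.induct)
  case (left a a' b)
  obtain c d where k: "k = Key c d" by (cases k)
  show ?case
    using tensor_relations.left[of "a * c" "a' * c" "b * d"]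
    by (simp add: k left_diff_distrib frag_of_Key_mult distrib_right)
next
  case (right a b b')
  obtain c d where k: "k = Key c d" by (cases k)
  show ?case
    using tensor_relations.right[of "a * c" "b * d" "b' * d"]
    by (simp add: k left_diff_distrib frag_of_Key_mult distrib_right)
qed (auto simp: left_diff_distrib intro: tensor_relations.intros)

lemma tensor_relations_mult:
  assumes "x \<in> tensor_relations"
  shows "x * y \<in> tensor_relations"
proof -
  have "Poly_Mapping.keys y \<subseteq> UNIV" by simp
  thus ?thesis
    by (induction y rule: frag_induction)
      (auto simp: right_diff_distrib assms intro: tensor_relations.zero tensor_relations.diff
        tensor_relations_mult_frag_of)
qed

definition tensor_rel ::
  "(('a::{comm_ring,comm_monoid_mult}, 'b::{comm_ring,comm_monoid_mult}) tensor_key \<Rightarrow>\<^sub>0 int) \<Rightarrow>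
   (('a, 'b) tensor_key \<Rightarrow>\<^sub>0 int) \<Rightarrow> bool" where
  "tensor_rel x y \<longleftrightarrow> x - y \<in> tensor_relations"

lemma tensor_rel_refl: "tensor_rel x x"
  by (simp add: tensor_rel_def tensor_relations.zero)

quotient_type (overloaded) ('a, 'b) tensor =
  "('a::{comm_ring,comm_monoid_mult}, 'b::{comm_ring,comm_monoid_mult}) tensor_key \<Rightarrow>\<^sub>0 int" / tensor_rel
proof (rule equivpI)
  show "reflp tensor_rel" by (simp add: reflp_def tensor_rel_refl)
  show "symp tensor_rel"
    unfolding symp_def tensor_rel_def by (metis minus_diff_eq tensor_relations_uminus)
  show "transp tensor_rel"
  proof (rule transpI)
    fix x y z
    assume "tensor_rel x y" "tensor_rel y z"
    hence "(x - y) + (y - z) \<in> tensor_relations"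
      unfolding tensor_rel_def by (rule tensor_relations_add)
    thus "tensor_rel x z" by (simp add: tensor_rel_def)
  qed
qed

instantiation tensor ::
  ("{comm_ring,comm_monoid_mult}", "{comm_ring,comm_monoid_mult}") "{comm_ring,comm_monoid_mult}"
begin

lift_definition zero_tensor :: "('a, 'b) tensor" is 0 .

lift_definition one_tensor :: "('a, 'b) tensor" is 1 .

lift_definition uminus_tensor :: "('a, 'b) tensor \<Rightarrow> ('a, 'b) tensor" is uminus
  unfolding tensor_rel_def using tensor_relations_uminus by (fastforce simp: algebra_simps)

lift_definition plus_tensor :: "('a, 'b) tensor \<Rightarrow> ('a, 'b) tensor \<Rightarrow> ('a, 'b) tensor" is "(+)"
proof -
  fix x x' y y' :: "('a, 'b) tensor_key \<Rightarrow>\<^sub>0 int"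
  assume "tensor_rel x x'" "tensor_rel y y'"
  hence "(x - x') + (y - y') \<in> tensor_relations"
    unfolding tensor_rel_def by (rule tensor_relations_add)
  thus "tensor_rel (x + y) (x' + y')" by (simp add: tensor_rel_def algebra_simps)
qed

lift_definition minus_tensor :: "('a, 'b) tensor \<Rightarrow> ('a, 'b) tensor \<Rightarrow> ('a, 'b) tensor" is "(-)"
proof -
  fix x x' y y' :: "('a, 'b) tensor_key \<Rightarrow>\<^sub>0 int"
  assume "tensor_rel x x'" "tensor_rel y y'"
  hence "(x - x') - (y - y') \<in> tensor_relations"
    unfolding tensor_rel_def by (rule tensor_relations.diff)
  thus "tensor_rel (x - y) (x' - y')" by (simp add: tensor_rel_def algebra_simps)
qed

lift_definition times_tensor :: "('a, 'b) tensor \<Rightarrow> ('a, 'b) tensor \<Rightarrow> ('a, 'b) tensor" is "(*)"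
proof -
  fix x x' y y' :: "('a, 'b) tensor_key \<Rightarrow>\<^sub>0 int"
  assume "tensor_rel x x'" "tensor_rel y y'"
  hence "(x - x') * y + (y - y') * x' \<in> tensor_relations"
    unfolding tensor_rel_def by (intro tensor_relations_add tensor_relations_mult)
  moreover have "(x - x') * y + (y - y') * x' = x * y - x' * y'" by (simp add: algebra_simps)
  ultimately show "tensor_rel (x * y) (x' * y')" by (simp add: tensor_rel_def)
qed

instance
  by intro_classes (transfer; simp add: algebra_simps tensor_rel_refl)+

end

lift_definition pure_tensor ::
  "'a::{comm_ring,comm_monoid_mult} \<Rightarrow> 'b::{comm_ring,comm_monoid_mult} \<Rightarrow> ('a, 'b) tensor"
  is "\<lambda>a b. frag_of (Key a b)" .

lemma pure_tensor_add_left: "pure_tensor (a + a') b = pure_tensor a b + pure_tensor a' b"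
  by transfer (use tensor_relations.left in \<open>simp add: tensor_rel_def diff_diff_eq\<close>)

lemma pure_tensor_add_right: "pure_tensor a (b + b') = pure_tensor a b + pure_tensor a b'"
  by transfer (use tensor_relations.right in \<open>simp add: tensor_rel_def diff_diff_eq\<close>)

lemma pure_tensor_mult: "pure_tensor a b * pure_tensor c d = pure_tensor (a * c) (b * d)"
  by transfer (simp add: frag_of_Key_mult tensor_rel_refl)

lemma pure_tensor_one: "pure_tensor 1 1 = 1"
proof transfer
  have "frag_of (Key 1 1) = (1 :: ('a, 'b) tensor_key \<Rightarrow>\<^sub>0 int)"
    by (simp flip: zero_tensor_key_def)
  thus "tensor_rel (frag_of (Key 1 1)) (1 :: ('a, 'b) tensor_key \<Rightarrow>\<^sub>0 int)"
    by (simp add: tensor_rel_refl)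
qed

definition tensor_scale ::
  "'a::{comm_ring,comm_monoid_mult} \<Rightarrow> ('a, 'b::{comm_ring,comm_monoid_mult}) tensor \<Rightarrow> ('a, 'b) tensor"
  where "tensor_scale r x = pure_tensor r 1 * x"

lemma tensor_scale_pure: "tensor_scale r (pure_tensor a b) = pure_tensor (r * a) b"
  by (simp add: tensor_scale_def pure_tensor_mult)

type_synonym 'r symm_fun_over = "('r, symm_fun) tensor"

text \<open>
  Linear independence of a family \<open>v\<close> indexed by \<open>I\<close> for a scalar multiplication \<open>scale\<close>. The
  library notion \<open>module.independent\<close> concerns sets of vectors rather than families, and excludes
  the zero ring.
\<close>

definition linearly_independent_family ::
  "('r::zero \<Rightarrow> 'm::comm_monoid_add \<Rightarrow> 'm) \<Rightarrow> 'i set \<Rightarrow> ('i \<Rightarrow> 'm) \<Rightarrow> bool" where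
  "linearly_independent_family scale I v \<longleftrightarrow>
    (\<forall>J c. finite J \<and> J \<subseteq> I \<and> (\<Sum>i\<in>J. scale (c i) (v i)) = 0 \<longrightarrow> (\<forall>i\<in>J. c i = 0))"

section \<open>Partitions and splittings\<close>

text \<open>Partitions are infinite sequences padded with zeros; parts are indexed from \<open>0\<close>.\<close>

typedef partition = "{\<mu> :: nat \<Rightarrow> nat. antimono \<mu> \<and> finite {i. \<mu> i \<noteq> 0}}"
  morphisms part Abs_partition
  by (rule exI[of _ "\<lambda>_. 0"]) (simp add: antimono_def)

setup_lifting type_definition_partition

instantiation partition :: plus
begin

lift_definition plus_partition :: "partition \<Rightarrow> partition \<Rightarrow> partition"
  is "\<lambda>\<alpha> \<beta> i. \<alpha> i + \<beta> i"
proof -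
  fix \<alpha> \<beta> :: "nat \<Rightarrow> nat"
  assume a: "antimono \<alpha> \<and> finite {i. \<alpha> i \<noteq> 0}" and b: "antimono \<beta> \<and> finite {i. \<beta> i \<noteq> 0}"
  have "{i. \<alpha> i + \<beta> i \<noteq> 0} = {i. \<alpha> i \<noteq> 0} \<union> {i. \<beta> i \<noteq> 0}" by auto
  thus "antimono (\<lambda>i. \<alpha> i + \<beta> i) \<and> finite {i. \<alpha> i + \<beta> i \<noteq> 0}"
    using a b by (auto simp: antimono_def intro: add_mono)
qed

instance ..

end

text \<open>An unordered pair whose entries may coincide is a multiset of size \<open>2\<close>.\<close>

definition Split :: "partition \<Rightarrow> partition multiset set" where
  "Split \<theta> = {{#\<alpha>, \<beta>#} | \<alpha> \<beta>. \<alpha> + \<beta> = \<theta>}"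

section \<open>Schur functions\<close>

definition diagram :: "(nat \<Rightarrow> nat) \<Rightarrow> (nat \<times> nat) set" where
  "diagram \<mu> = {(i, j). j < \<mu> i}"

text \<open>
  Semistandard tableaux, with entries from \<open>0\<close> on so that the entry \<open>k\<close> stands for the variable
  \<open>x\<^sub>k\<close>. The value \<open>0\<close> outside the diagram only makes the representing function unique.
\<close>

definition ssyt :: "(nat \<Rightarrow> nat) \<Rightarrow> (nat \<Rightarrow> nat \<Rightarrow> nat) set" where
  "ssyt \<mu> = {T.
     (\<forall>i j. (i, j) \<notin> diagram \<mu> \<longrightarrow> T i j = 0) \<and>
     (\<forall>i j. (i, Suc j) \<in> diagram \<mu> \<longrightarrow> T i j \<le> T i (Suc j)) \<and>
     (\<forall>i j. (Suc i, j) \<in> diagram \<mu> \<longrightarrow> T i j < T (Suc i) j)}"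

definition content :: "(nat \<Rightarrow> nat) \<Rightarrow> (nat \<Rightarrow> nat \<Rightarrow> nat) \<Rightarrow> nat \<Rightarrow> nat" where
  "content \<mu> T k = card {(i, j) \<in> diagram \<mu>. T i j = k}"

definition ssyt_with_content :: "(nat \<Rightarrow> nat) \<Rightarrow> (nat \<Rightarrow> nat) \<Rightarrow> (nat \<Rightarrow> nat \<Rightarrow> nat) set" where
  "ssyt_with_content \<mu> w = {T \<in> ssyt \<mu>. content \<mu> T = w}"

lemma finite_diagram:
  assumes "finite {i. \<mu> i \<noteq> 0}"
  shows "finite (diagram \<mu>)"
proof -
  have "diagram \<mu> = Sigma {i. \<mu> i \<noteq> 0} (\<lambda>i. {..<\<mu> i})"
    by (auto simp: diagram_def)
  thus ?thesis using assms by simp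
qed

lemma finite_ssyt_with_content:
  assumes "finite {i. \<mu> i \<noteq> 0}" "finite {k. w k \<noteq> 0}"
  shows "finite (ssyt_with_content \<mu> w)"
proof -
  let ?F = "{f. \<forall>x. (x \<in> diagram \<mu> \<longrightarrow> f x \<in> {k. w k \<noteq> 0}) \<and> (x \<notin> diagram \<mu> \<longrightarrow> f x = (0::nat))}"
  have "case_prod ` ssyt_with_content \<mu> w \<subseteq> ?F"
  proof (rule image_subsetI)
    fix T assume T: "T \<in> ssyt_with_content \<mu> w"
    have "w (T i j) \<noteq> 0" if "(i, j) \<in> diagram \<mu>" for i j
    proof -
      define A where "A = {(i', j') \<in> diagram \<mu>. T i' j' = T i j}"
      have "A \<subseteq> diagram \<mu>" by (auto simp: A_def)
      hence "finite A" using finite_diagram[OF assms(1)] by (rule finite_subset)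
      moreover have "(i, j) \<in> A" using that by (simp add: A_def)
      ultimately have "card A \<noteq> 0" by auto
      hence "content \<mu> T (T i j) \<noteq> 0" by (simp add: content_def A_def)
      thus ?thesis using T by (auto simp: ssyt_with_content_def)
    qed
    thus "case_prod T \<in> ?F" using T by (auto simp: ssyt_with_content_def ssyt_def)
  qed
  moreover have "finite ?F"
    using finite_diagram[OF assms(1)] assms(2) by (rule finite_set_of_finite_funs)
  ultimately have "finite (case_prod ` ssyt_with_content \<mu> w)" by (rule finite_subset)
  thus ?thesis by (rule finite_imageD) (auto simp: inj_on_def fun_eq_iff)
qed

text \<open>
  Symmetry of Schur functions, by the involution of Bender and Knuth: in each row, the
  entries \<open>k\<close> and \<open>k + 1\<close> are redistributed by reflecting the boundary between them in the interval
  of its admissible positions.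
\<close>

definition row_count :: "(nat \<Rightarrow> nat) \<Rightarrow> (nat \<Rightarrow> nat \<Rightarrow> nat) \<Rightarrow> nat \<Rightarrow> nat \<Rightarrow> nat" where
  "row_count \<mu> T c i = card {j. j < \<mu> i \<and> T i j < c}"

definition bk_lo :: "nat \<Rightarrow> (nat \<Rightarrow> nat) \<Rightarrow> (nat \<Rightarrow> nat \<Rightarrow> nat) \<Rightarrow> nat \<Rightarrow> nat" where
  "bk_lo k \<mu> T i = max (row_count \<mu> T k i) (row_count \<mu> T (k + 2) (Suc i))"

definition bk_hi :: "nat \<Rightarrow> (nat \<Rightarrow> nat) \<Rightarrow> (nat \<Rightarrow> nat \<Rightarrow> nat) \<Rightarrow> nat \<Rightarrow> nat" where
  "bk_hi k \<mu> T i = (case i of 0 \<Rightarrow> row_count \<mu> T (k + 2) 0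
     | Suc i' \<Rightarrow> min (row_count \<mu> T (k + 2) i) (row_count \<mu> T k i'))"

definition bk_cut :: "nat \<Rightarrow> (nat \<Rightarrow> nat) \<Rightarrow> (nat \<Rightarrow> nat \<Rightarrow> nat) \<Rightarrow> nat \<Rightarrow> nat" where
  "bk_cut k \<mu> T i = bk_lo k \<mu> T i + bk_hi k \<mu> T i - row_count \<mu> T (k + 1) i"

definition bk :: "nat \<Rightarrow> (nat \<Rightarrow> nat) \<Rightarrow> (nat \<Rightarrow> nat \<Rightarrow> nat) \<Rightarrow> nat \<Rightarrow> nat \<Rightarrow> nat" where
  "bk k \<mu> T i j =
    (if j < \<mu> i \<and> T i j \<in> {k, Suc k} then (if j < bk_cut k \<mu> T i then k else Suc k) else T i j)"

context
  fixes \<mu> :: "nat \<Rightarrow> nat" and T :: "nat \<Rightarrow> nat \<Rightarrow> nat"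
  assumes \<mu>: "antimono \<mu>" and T: "T \<in> ssyt \<mu>"
begin

lemma ssyt_row: "j \<le> j' \<Longrightarrow> j' < \<mu> i \<Longrightarrow> T i j \<le> T i j'"
proof (induction j' rule: dec_induct)
  case (step n)
  hence "T i n \<le> T i (Suc n)" using T by (simp add: ssyt_def diagram_def)
  thus ?case using step by force
qed simp

lemma ssyt_col: "j < \<mu> (Suc i) \<Longrightarrow> T i j < T (Suc i) j"
  using T by (simp add: ssyt_def diagram_def)

lemma part_Suc_le: "\<mu> (Suc i) \<le> \<mu> i"
  using \<mu> by (simp add: antimono_def)

lemma row_set: "{j. j < \<mu> i \<and> T i j < c} = {..<row_count \<mu> T c i}"
proof -
  let ?S = "{j. j < \<mu> i \<and> T i j < c}"
  have down: "j \<in> ?S" if "j' \<in> ?S" "j \<le> j'" for j j'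
    using that ssyt_row[of j j' i] by auto
  have fin: "finite ?S" by simp
  have "?S \<subseteq> {..<card ?S}"
  proof
    fix j assume j: "j \<in> ?S"
    hence "{..j} \<subseteq> ?S" using down by auto
    from card_mono[OF fin this] show "j \<in> {..<card ?S}" by simp
  qed
  moreover have "card ?S = card {..<card ?S}" by simp
  ultimately have "?S = {..<card ?S}" by (intro card_subset_eq) auto
  thus ?thesis by (simp add: row_count_def)
qed

lemma row_count_iff: "j < row_count \<mu> T c i \<longleftrightarrow> j < \<mu> i \<and> T i j < c"
  using row_set[of i c] by auto

lemma row_count_mono: "c \<le> d \<Longrightarrow> row_count \<mu> T c i \<le> row_count \<mu> T d i"
  using row_count_iff by (meson leI less_le_trans nat_neq_iff order_less_irrefl)

lemma row_count_Suc_row: "row_count \<mu> T (Suc c) (Suc i) \<le> row_count \<mu> T c i"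
proof (rule ccontr)
  assume "\<not> ?thesis"
  hence "row_count \<mu> T c i < row_count \<mu> T (Suc c) (Suc i)" by simp
  hence 1: "row_count \<mu> T c i < \<mu> (Suc i)" "T (Suc i) (row_count \<mu> T c i) < Suc c"
    by (simp_all add: row_count_iff)
  have "row_count \<mu> T c i < row_count \<mu> T c i"
    unfolding row_count_iff[of "row_count \<mu> T c i"]
    using 1 ssyt_col[OF 1(1)] part_Suc_le[of i] by auto
  thus False by simp
qed

lemma bk_bounds: "bk_lo k \<mu> T i \<le> row_count \<mu> T (Suc k) i" "row_count \<mu> T (Suc k) i \<le> bk_hi k \<mu> T i"
  using row_count_mono[of k "Suc k" i] row_count_mono[of "Suc k" "k + 2" i]
    row_count_Suc_row[of "Suc k" i] row_count_Suc_row[of k "i - 1"]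
  by (auto simp: bk_lo_def bk_hi_def split: nat.split)

lemma bk_cut_bounds: "bk_lo k \<mu> T i \<le> bk_cut k \<mu> T i" "bk_cut k \<mu> T i \<le> bk_hi k \<mu> T i"
  "bk_cut k \<mu> T i + row_count \<mu> T (Suc k) i = bk_lo k \<mu> T i + bk_hi k \<mu> T i"
  using bk_bounds[where k = k and i = i] by (auto simp: bk_cut_def)

lemma bk_cut_bounds':
  "row_count \<mu> T k i \<le> bk_cut k \<mu> T i" "bk_cut k \<mu> T i \<le> row_count \<mu> T (k + 2) i"
  "row_count \<mu> T (k + 2) (Suc i) \<le> bk_cut k \<mu> T i" "bk_cut k \<mu> T (Suc i) \<le> row_count \<mu> T k i"
  using bk_cut_bounds[where k = k and i = i] bk_cut_bounds[where k = k and i = "Suc i"]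
  by (auto simp: bk_lo_def bk_hi_def split: nat.splits)

text \<open>The entry at \<open>(i, j)\<close> belongs to \<open>{k, k + 1}\<close> iff \<open>j\<close> lies between two row counts.\<close>

lemma bk_entry_iff:
  "j < \<mu> i \<and> T i j \<in> {k, Suc k} \<longleftrightarrow> row_count \<mu> T k i \<le> j \<and> j < row_count \<mu> T (k + 2) i"
proof -
  have "j < row_count \<mu> T (k + 2) i \<longleftrightarrow> j < \<mu> i \<and> T i j < k + 2" by (rule row_count_iff)
  moreover have "row_count \<mu> T k i \<le> j \<longleftrightarrow> \<not> (j < \<mu> i \<and> T i j < k)"
    by (simp only: row_count_iff[symmetric] not_less)
  ultimately show ?thesis by auto
qed

lemma bk_in_ssyt: "bk k \<mu> T \<in> ssyt \<mu>"
proof -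
  have 1: "bk k \<mu> T i j = 0" if "(i, j) \<notin> diagram \<mu>" for i j
    using that T by (auto simp: bk_def ssyt_def diagram_def)
  have 2: "bk k \<mu> T i j \<le> bk k \<mu> T i (Suc j)" if "(i, Suc j) \<in> diagram \<mu>" for i j
  proof -
    have "Suc j < \<mu> i" using that by (simp add: diagram_def)
    thus ?thesis using ssyt_row[of j "Suc j" i] by (auto simp: bk_def)
  qed
  have 3: "bk k \<mu> T i j < bk k \<mu> T (Suc i) j" if "(Suc i, j) \<in> diagram \<mu>" for i j
  proof -
    have j: "j < \<mu> (Suc i)" "j < \<mu> i"
      using that part_Suc_le[of i] by (auto simp: diagram_def)
    have lt: "T i j < T (Suc i) j" by (rule ssyt_col[OF j(1)])
    show ?thesis
    proof (cases "T i j \<in> {k, Suc k} \<and> T (Suc i) j \<in> {k, Suc k}")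
      case True
      have "row_count \<mu> T k i \<le> j" "j < row_count \<mu> T (k + 2) (Suc i)"
        using True bk_entry_iff[of j i k] bk_entry_iff[of j "Suc i" k] j by auto
      thus ?thesis using True j bk_cut_bounds'(3,4)[of k i] by (auto simp: bk_def)
    next
      case False
      thus ?thesis using lt j by (auto simp: bk_def)
    qed
  qed
  show ?thesis using 1 2 3 by (auto simp: ssyt_def)
qed

lemma bk_row_count:
  "row_count \<mu> (bk k \<mu> T) k i = row_count \<mu> T k i"
  "row_count \<mu> (bk k \<mu> T) (k + 2) i = row_count \<mu> T (k + 2) i"
  "row_count \<mu> (bk k \<mu> T) (Suc k) i = bk_cut k \<mu> T i"
proof -
  have "{j. j < \<mu> i \<and> bk k \<mu> T i j < k} = {j. j < \<mu> i \<and> T i j < k}" by (auto simp: bk_def)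
  thus "row_count \<mu> (bk k \<mu> T) k i = row_count \<mu> T k i" by (simp add: row_count_def)
  have "{j. j < \<mu> i \<and> bk k \<mu> T i j < k + 2} = {j. j < \<mu> i \<and> T i j < k + 2}" by (auto simp: bk_def)
  thus "row_count \<mu> (bk k \<mu> T) (k + 2) i = row_count \<mu> T (k + 2) i" by (simp add: row_count_def)
  have "j < \<mu> i \<and> bk k \<mu> T i j < Suc k \<longleftrightarrow> j < bk_cut k \<mu> T i" for j
    using bk_entry_iff[of j i k] row_count_iff[of j k i] row_count_iff[of j "k + 2" i]
      bk_cut_bounds'(1,2)[of k i]
    by (cases "j < \<mu> i \<and> T i j \<in> {k, Suc k}") (auto simp: bk_def)
  hence "{j. j < \<mu> i \<and> bk k \<mu> T i j < Suc k} = {..<bk_cut k \<mu> T i}" by auto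
  thus "row_count \<mu> (bk k \<mu> T) (Suc k) i = bk_cut k \<mu> T i" by (simp add: row_count_def)
qed

lemma bk_involutive: "bk k \<mu> (bk k \<mu> T) = T"
proof (intro ext)
  fix i j
  have lohi: "bk_lo k \<mu> (bk k \<mu> T) i = bk_lo k \<mu> T i" "bk_hi k \<mu> (bk k \<mu> T) i = bk_hi k \<mu> T i"
    using bk_row_count(1,2) by (auto simp: bk_lo_def bk_hi_def split: nat.split)
  have cut: "bk_cut k \<mu> (bk k \<mu> T) i = row_count \<mu> T (Suc k) i"
    using bk_cut_bounds(3)[of k i] bk_row_count(3)[of k i] lohi
    unfolding bk_cut_def[of k \<mu> "bk k \<mu> T"] by simp
  show "bk k \<mu> (bk k \<mu> T) i j = T i j"
    unfolding bk_def[of k \<mu> "bk k \<mu> T"] cut row_count_iff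
    by (auto simp: bk_def)
qed

lemma content_eq_sum:
  assumes L: "\<And>i. i \<ge> L \<Longrightarrow> \<mu> i = 0"
  shows "content \<mu> T c = (\<Sum>i<L. row_count \<mu> T (Suc c) i - row_count \<mu> T c i)"
proof -
  have lt: "i < L" if "j < \<mu> i" for i j using that L[of i] by (cases "i < L") auto
  have eq: "{(i, j) \<in> diagram \<mu>. T i j = c} = Sigma {..<L} (\<lambda>i. {row_count \<mu> T c i..<row_count \<mu> T (Suc c) i})"
  proof -
    have "j < \<mu> i \<and> T i j = c \<longleftrightarrow> row_count \<mu> T c i \<le> j \<and> j < row_count \<mu> T (Suc c) i" for i j
    proof -
      have "row_count \<mu> T c i \<le> j \<longleftrightarrow> \<not> (j < \<mu> i \<and> T i j < c)"
        by (simp only: row_count_iff[symmetric] not_less)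
      thus ?thesis using row_count_iff[of j "Suc c" i] by auto
    qed
    thus ?thesis using lt by (auto simp: diagram_def)
  qed
  show ?thesis unfolding content_def eq by simp
qed

end

lemma content_bk:
  assumes \<mu>: "antimono \<mu>" and fin: "finite {i. \<mu> i \<noteq> 0}" and T: "T \<in> ssyt \<mu>"
  shows "content \<mu> (bk k \<mu> T) = content \<mu> T \<circ> transpose k (Suc k)"
proof
  fix c
  obtain L where "\<forall>i\<in>{i. \<mu> i \<noteq> 0}. i < L"
    using finite_nat_set_iff_bounded fin by blast
  hence L: "\<mu> i = 0" if "i \<ge> L" for i using that by (meson leD mem_Collect_eq)
  hence L': "\<mu> i = 0" if "i \<ge> Suc L" for i using that by simp
  note mono = row_count_mono[OF \<mu> T]
  note bT = bk_in_ssyt[OF \<mu> T, of k]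
  note ct = content_eq_sum[OF \<mu> T L']
  note ct' = content_eq_sum[OF \<mu> bT L']
  note bc = bk_cut_bounds'[OF \<mu> T, of k]
  let ?m = "row_count \<mu> T k" and ?n = "row_count \<mu> T (Suc k)" and ?r = "row_count \<mu> T (Suc (Suc k))"
  let ?n' = "bk_cut k \<mu> T"
  let ?S = "\<lambda>f. \<Sum>i<Suc L. f i :: nat"
  have z: "row_count \<mu> T d L = 0" for d using L[of L] by (simp add: row_count_def)
  have zS: "row_count \<mu> T d (Suc L) = 0" for d using L[of "Suc L"] by (simp add: row_count_def)
  have max_min: "max a b + min b a = b + a" for a b :: nat by simp
  have "?S ?n' + ?S ?n = ?S (\<lambda>i. bk_lo k \<mu> T i) + ?S (\<lambda>i. bk_hi k \<mu> T i)"
    unfolding sum.distrib[symmetric] using bk_cut_bounds(3)[OF \<mu> T, of k] by simp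
  also have "?S (\<lambda>i. bk_lo k \<mu> T i) = (\<Sum>i<L. max (?m i) (?r (Suc i)))"
    by (simp add: bk_lo_def z zS)
  also have "?S (\<lambda>i. bk_hi k \<mu> T i) = ?r 0 + (\<Sum>i<L. min (?r (Suc i)) (?m i))"
    unfolding sum.lessThan_Suc_shift by (simp add: bk_hi_def)
  also have "(\<Sum>i<L. max (?m i) (?r (Suc i))) + (?r 0 + (\<Sum>i<L. min (?r (Suc i)) (?m i)))
      = ?r 0 + (\<Sum>i<L. max (?m i) (?r (Suc i)) + min (?r (Suc i)) (?m i))"
    by (simp add: sum.distrib)
  also have "\<dots> = ?r 0 + (\<Sum>i<L. ?r (Suc i) + ?m i)"
    by (simp only: max_min)
  also have "\<dots> = ?S ?r + (\<Sum>i<L. ?m i)"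
    unfolding sum.lessThan_Suc_shift by (simp add: sum.distrib)
  also have "(\<Sum>i<L. ?m i) = ?S ?m" by (simp add: z)
  finally have key: "?S ?n' + ?S ?n = ?S ?r + ?S ?m" .
  have sub: "?S (\<lambda>i. f i - g i) = ?S f - ?S g" "?S g \<le> ?S f" if "\<And>i. g i \<le> f i" for f g :: "nat \<Rightarrow> nat"
    using that by (intro sum_subtractf_nat sum_mono; simp)+
  have b: "?m i \<le> ?n' i" "?n' i \<le> ?r i" "?m i \<le> ?n i" "?n i \<le> ?r i" for i
    using bc(1,2)[of i] mono[of k "Suc k" i] mono[of "Suc k" "Suc (Suc k)" i] by simp_all
  note rc = bk_row_count[OF \<mu> T, of k]
  have rc2: "row_count \<mu> (bk k \<mu> T) (Suc (Suc k)) i = ?r i" for i using rc(2)[of i] by simp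
  consider "c = k" | "c = Suc k" | "c \<notin> {k, Suc k}" by blast
  thus "content \<mu> (bk k \<mu> T) c = (content \<mu> T \<circ> transpose k (Suc k)) c"
  proof cases
    case 1
    have "?S (\<lambda>i. ?n' i - ?m i) = ?S (\<lambda>i. ?r i - ?n i)"
      using key sub[of ?m ?n', OF b(1)] sub[of ?n ?r, OF b(4)] by linarith
    thus ?thesis using 1 by (simp add: ct ct' rc rc2 del: sum.lessThan_Suc)
  next
    case 2
    have "?S (\<lambda>i. ?r i - ?n' i) = ?S (\<lambda>i. ?n i - ?m i)"
      using key sub[of ?n' ?r, OF b(2)] sub[of ?m ?n, OF b(3)] by linarith
    thus ?thesis using 2 by (simp add: ct ct' rc rc2 del: sum.lessThan_Suc)
  next
    case 3
    hence "{(i, j) \<in> diagram \<mu>. bk k \<mu> T i j = c} = {(i, j) \<in> diagram \<mu>. T i j = c}"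
      by (auto simp: bk_def diagram_def)
    thus ?thesis using 3 by (simp add: content_def transpose_def)
  qed
qed

lemma ssyt_count_adjacent:
  assumes \<mu>: "antimono \<mu>" "finite {i. \<mu> i \<noteq> 0}"
  shows "card (ssyt_with_content \<mu> (w \<circ> transpose k (Suc k))) = card (ssyt_with_content \<mu> w)"
proof (rule bij_betw_same_card, rule bij_betw_byWitness[where f = "bk k \<mu>" and f' = "bk k \<mu>"])
  have tt: "w \<circ> transpose k (Suc k) \<circ> transpose k (Suc k) = w" for w :: "nat \<Rightarrow> nat"
    by (simp add: comp_assoc)
  show "\<forall>T\<in>ssyt_with_content \<mu> (w \<circ> transpose k (Suc k)). bk k \<mu> (bk k \<mu> T) = T"
    "\<forall>T\<in>ssyt_with_content \<mu> w. bk k \<mu> (bk k \<mu> T) = T"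
    using bk_involutive[OF \<mu>(1)] by (auto simp: ssyt_with_content_def)
  show "bk k \<mu> ` ssyt_with_content \<mu> (w \<circ> transpose k (Suc k)) \<subseteq> ssyt_with_content \<mu> w"
    "bk k \<mu> ` ssyt_with_content \<mu> w \<subseteq> ssyt_with_content \<mu> (w \<circ> transpose k (Suc k))"
    using bk_in_ssyt[OF \<mu>(1)] content_bk[OF \<mu>]
    by (auto simp: ssyt_with_content_def tt)
qed

lemma ssyt_count_transpose:
  assumes \<mu>: "antimono \<mu>" "finite {i. \<mu> i \<noteq> 0}"
  shows "card (ssyt_with_content \<mu> (w \<circ> transpose a b)) = card (ssyt_with_content \<mu> w)"
proof -
  have lt: "card (ssyt_with_content \<mu> (w \<circ> transpose a b)) = card (ssyt_with_content \<mu> w)"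
    if "Suc a \<le> b" for a b w
    using that
  proof (induction b arbitrary: w rule: dec_induct)
    case base
    thus ?case using ssyt_count_adjacent[OF \<mu>] by blast
  next
    case (step b)
    have "transpose a (Suc b) = transpose b (Suc b) \<circ> transpose a b \<circ> transpose b (Suc b)"
      using step.hyps by (auto simp: fun_eq_iff transpose_def)
    thus ?case using ssyt_count_adjacent[OF \<mu>] step.IH by (metis comp_assoc)
  qed
  show ?thesis
    using lt[of a b w] lt[of b a w]
    by (cases a b rule: linorder_cases) (auto simp: transpose_commute)
qed

lemma ssyt_count_bij:
  assumes \<mu>: "antimono \<mu>" "finite {i. \<mu> i \<noteq> 0}" and \<pi>: "bij \<pi>" and w: "finite {k. w k \<noteq> 0}"
  shows "card (ssyt_with_content \<mu> (w \<circ> \<pi>)) = card (ssyt_with_content \<mu> w)"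
proof -
  let ?S = "{k. w k \<noteq> 0}" and ?S' = "{k. w (\<pi> k) \<noteq> 0}"
  have inj: "inj \<pi>" and surj: "surj \<pi>" using \<pi> by (auto simp: bij_def)
  have im: "\<pi> ` ?S' = ?S"
  proof
    show "?S \<subseteq> \<pi> ` ?S'"
    proof
      fix k assume "k \<in> ?S"
      thus "k \<in> \<pi> ` ?S'" using surj by (intro image_eqI[of _ _ "inv \<pi> k"]) (auto simp: surj_f_inv_f)
    qed
  qed auto
  have fin': "finite ?S'" using w im inj by (metis finite_imageD inj_on_subset subset_UNIV)
  have card: "card ?S' = card ?S" using im inj by (metis card_image inj_on_subset subset_UNIV)
  let ?U = "?S \<union> ?S'"
  have "card (?U - ?S') = card (?U - ?S)"
    using card w fin' by (simp add: card_Diff_subset)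
  then obtain h where h: "bij_betw h (?U - ?S') (?U - ?S)"
    using finite_same_card_bij w fin' by (metis finite_Diff finite_UnI)
  define \<sigma> where "\<sigma> k = (if k \<in> ?S' then \<pi> k else if k \<in> ?U then h k else k)" for k
  have "bij_betw \<sigma> ?S' ?S"
    using im inj by (auto simp: bij_betw_def inj_on_def \<sigma>_def image_def)
  moreover have "bij_betw \<sigma> (?U - ?S') (?U - ?S)"
    using h by (subst bij_betw_cong[of _ _ h]) (auto simp: \<sigma>_def)
  ultimately have "bij_betw \<sigma> (?S' \<union> (?U - ?S')) (?S \<union> (?U - ?S))"
    by (rule bij_betw_combine) auto
  moreover have "?S' \<union> (?U - ?S') = ?U" "?S \<union> (?U - ?S) = ?U" by auto
  ultimately have "bij_betw \<sigma> ?U ?U" by simp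
  hence perm: "\<sigma> permutes ?U" by (rule bij_imp_permutes) (auto simp: \<sigma>_def)
  have fin_U: "finite ?U" using w fin' by simp
  have "w \<circ> \<pi> = w \<circ> \<sigma>"
  proof
    fix k
    consider "k \<in> ?S'" | "k \<in> ?U - ?S'" | "k \<notin> ?U" by blast
    thus "(w \<circ> \<pi>) k = (w \<circ> \<sigma>) k"
    proof cases
      case 2
      hence "h k \<in> ?U - ?S" by (rule bij_betw_apply[OF h])
      thus ?thesis using 2 by (auto simp: \<sigma>_def)
    qed (auto simp: \<sigma>_def)
  qed
  moreover have "\<forall>w. card (ssyt_with_content \<mu> (w \<circ> \<sigma>)) = card (ssyt_with_content \<mu> w)"
    using perm fin_U
  proof (induction \<sigma> rule: permutes_induct)
    case id
    show ?case by simp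
  next
    case (swap a b p)
    thus ?case using ssyt_count_transpose[OF \<mu>] by (simp only: comp_assoc[symmetric]) simp
  qed
  ultimately show ?thesis by simp
qed

lemma sum_content:
  assumes "finite {i. \<mu> i \<noteq> 0}" "finite S" "\<And>k. k \<notin> S \<Longrightarrow> content \<mu> T k = 0"
  shows "sum (content \<mu> T) S = card (diagram \<mu>)"
proof -
  have fin: "finite (diagram \<mu>)" by (rule finite_diagram[OF assms(1)])
  have "diagram \<mu> = (\<Union>k\<in>S. {(i, j) \<in> diagram \<mu>. T i j = k})"
  proof -
    have "T i j \<in> S" if "(i, j) \<in> diagram \<mu>" for i j
    proof (rule ccontr)
      assume "T i j \<notin> S"
      define A where "A = {(i', j') \<in> diagram \<mu>. T i' j' = T i j}"
      have "A \<subseteq> diagram \<mu>" by (auto simp: A_def)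
      hence "finite A" using fin by (rule finite_subset)
      moreover have "(i, j) \<in> A" using that by (simp add: A_def)
      ultimately have "card A \<noteq> 0" by auto
      hence "content \<mu> T (T i j) \<noteq> 0" by (simp add: content_def A_def)
      thus False using \<open>T i j \<notin> S\<close> assms(3) by simp
    qed
    thus ?thesis by auto
  qed
  also have "card \<dots> = (\<Sum>k\<in>S. card {(i, j) \<in> diagram \<mu>. T i j = k})"
    by (rule card_UN_disjoint) (auto simp: assms(2) intro: finite_subset[OF _ fin])
  finally show ?thesis by (simp add: content_def)
qed

text \<open>\<open>schur \<mu> = (\<Sum>T. x\<^sup>T)\<close>, the sum being over all semistandard tableaux of shape \<open>\<mu>\<close>.\<close>

lift_definition schur :: "partition \<Rightarrow> symm_fun"
  is "\<lambda>\<mu> m. int (card (ssyt_with_content \<mu> (Poly_Mapping.lookup m)))"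
proof
  fix \<mu> :: "nat \<Rightarrow> nat" assume \<mu>: "antimono \<mu> \<and> finite {i. \<mu> i \<noteq> 0}"
  show "symmetric_series (\<lambda>m. int (card (ssyt_with_content \<mu> (Poly_Mapping.lookup m))))"
    unfolding symmetric_series_def
  proof (intro allI impI)
    fix \<pi> :: "nat \<Rightarrow> nat" and m :: monomial assume \<pi>: "bij \<pi>"
    have "Poly_Mapping.lookup (Poly_Mapping.map_key \<pi> m) = Poly_Mapping.lookup m \<circ> \<pi>"
      using \<pi> by (simp add: map_key.rep_eq bij_is_inj)
    thus "int (card (ssyt_with_content \<mu> (Poly_Mapping.lookup (Poly_Mapping.map_key \<pi> m))))
        = int (card (ssyt_with_content \<mu> (Poly_Mapping.lookup m)))"
      using ssyt_count_bij[OF _ _ \<pi>] \<mu> by simp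
  qed
  have "monomial_deg m \<le> card (diagram \<mu>)"
    if "int (card (ssyt_with_content \<mu> (Poly_Mapping.lookup m))) \<noteq> 0" for m
  proof -
    have "ssyt_with_content \<mu> (Poly_Mapping.lookup m) \<noteq> {}" using that by auto
    then obtain T where T: "content \<mu> T = Poly_Mapping.lookup m" by (auto simp: ssyt_with_content_def)
    have "sum (content \<mu> T) (Poly_Mapping.keys m) = card (diagram \<mu>)"
      by (rule sum_content) (use \<mu> in \<open>auto simp: T in_keys_iff\<close>)
    thus ?thesis by (simp add: T monomial_deg_def)
  qed
  thus "bounded_degree (\<lambda>m. int (card (ssyt_with_content \<mu> (Poly_Mapping.lookup m))))"
    by (auto simp: bounded_degree_def)
qed

definition schur_over :: "partition \<Rightarrow> 'r::{comm_ring,comm_monoid_mult} symm_fun_over" where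
  "schur_over \<mu> = pure_tensor 1 (schur \<mu>)"

end

theory Submission
  imports Defs
begin

text \<open>
  Let \<open>\<theta>\<close> have \<open>n\<close> parts, and let \<open>p\<^sub>k\<^sup>\<bottom>\<close> be the adjoint of multiplication by the power sum \<open>p\<^sub>k\<close>. It is a
  derivation, so \<open>p\<^sub>k\<^sup>\<bottom> (s\<^sub>\<alpha> s\<^sub>\<beta>)\<close> is \<open>(p\<^sub>k\<^sup>\<bottom> s\<^sub>\<alpha>) s\<^sub>\<beta>\<close> plus the same term with \<open>\<alpha>\<close> and \<open>\<beta>\<close> exchanged, and
  this breaks the symmetry between the two factors. By the Murnaghan-Nakayama rule \<open>p\<^sub>k\<^sup>\<bottom> s\<^sub>\<alpha>\<close> is a signed
  sum of Schur functions \<open>s\<^sub>\<rho>\<close> with \<open>\<rho>\<^sub>i \<ge> \<alpha>\<^sub>i\<^sub>+\<^sub>1 - 1\<close>, where equality throughout means that the full rim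
  of \<open>\<alpha>\<close> was removed.

  Given a linear relation, choose among the ordered pairs \<open>(\<alpha>, \<beta>)\<close> with nonzero coefficient one for
  which \<open>(\<beta>\<^sub>n, \<dots>, \<beta>\<^sub>1)\<close> is lexicographically least, and let \<open>\<rho>\<close> be \<open>\<alpha>\<close> without its rim. After
  applying \<open>p\<^sub>k\<^sup>\<bottom>\<close> with \<open>k = |\<alpha>| - |\<rho>|\<close> and restricting to \<open>n\<close> variables, the monomial \<open>x\<^sup>\<rho>\<^sup>+\<^sup>\<beta>\<close> occurs
  only in \<open>(p\<^sub>k\<^sup>\<bottom> s\<^sub>\<alpha>) s\<^sub>\<beta>\<close>, with coefficient \<open>\<plusminus>1\<close>: in \<open>n\<close> variables the last \<open>j\<close> exponents of any
  monomial of \<open>s\<^sub>\<mu>\<close> add up to at least the sum of the last \<open>j\<close> rows of \<open>\<mu>\<close>, and by minimality this forces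
  any other contributing pair to agree with \<open>(\<alpha>, \<beta>)\<close> row by row, from the bottom up. If \<open>\<alpha> = \<beta>\<close>, the
  relation has no other term, and \<open>x\<^sup>2\<^sup>\<alpha>\<close> has coefficient \<open>1\<close> in \<open>s\<^sub>\<alpha>\<^sup>2\<close>.
\<close>

section \<open>A derivation on functions of contents\<close>

text \<open>Reading \<open>f l\<close> as the pairing of a symmetric function with \<open>h\<^sub>l\<close>, the value \<open>newton f k\<close> is its
  pairing with the power sum \<open>p\<^sub>k\<close>, computed by Newton's identity
  \<open>p\<^sub>k = k h\<^sub>k - (\<Sum>1 \<le> a < k. h\<^sub>a p\<^sub>k\<^sub>-\<^sub>a)\<close>. As \<open>p\<^sub>k\<close> is primitive, this is a derivation on products.\<close>

fun newton :: "(nat list \<Rightarrow> int) \<Rightarrow> nat \<Rightarrow> int" where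
  "newton f k = int k * f [k] - (\<Sum>a\<in>{1..<k}. newton (\<lambda>l. f (a # l)) (k - a))"

declare newton.simps [simp del]

text \<open>If \<open>f\<close> and \<open>g\<close> give the coefficients of two series,
  \<open>conv l f g\<close> is the coefficient of their product at \<open>l\<close>. Dually, each
  letter \<open>h\<^sub>a\<close> is replaced by its coproduct, the sum of all
  \<open>h\<^sub>i \<otimes> h\<^sub>a\<^sub>-\<^sub>i\<close>.\<close>

primrec conv :: "nat list \<Rightarrow> (nat list \<Rightarrow> int) \<Rightarrow> (nat list \<Rightarrow> int) \<Rightarrow> int" where
  "conv [] f g = f [] * g []"
| "conv (a # l) f g = (\<Sum>i\<le>a. conv l (\<lambda>l. f (i # l)) (\<lambda>l. g ((a - i) # l)))"

text \<open>Encodes \<open>h\<^sub>0 = 1\<close>.\<close>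

definition zero_insensitive :: "(nat list \<Rightarrow> int) \<Rightarrow> bool" where
  "zero_insensitive f \<longleftrightarrow> (\<forall>p l. f (p @ 0 # l) = f (p @ l))"

lemma zero_insensitive_Cons: "zero_insensitive f \<Longrightarrow> zero_insensitive (\<lambda>l. f (a # l))"
  unfolding zero_insensitive_def by (metis append_Cons)

lemma zero_insensitive_head: "zero_insensitive f \<Longrightarrow> f (0 # l) = f l"
  unfolding zero_insensitive_def by (metis append_Nil)

lemma newton_sum: "newton (\<lambda>l. \<Sum>x\<in>A. f x l) k = (\<Sum>x\<in>A. newton (f x) k)"
proof (induction k arbitrary: f rule: less_induct)
  case (less k)
  have "newton (\<lambda>l. \<Sum>x\<in>A. f x l) k =
      (\<Sum>x\<in>A. int k * f x [k]) - (\<Sum>a\<in>{1..<k}. \<Sum>x\<in>A. newton (\<lambda>l. f x (a # l)) (k - a))"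
    by (subst newton.simps) (simp add: less sum_distrib_left)
  also have "\<dots> = (\<Sum>x\<in>A. newton (f x) k)"
    by (subst sum.swap) (simp add: newton.simps[of "f _" k] sum_subtractf)
  finally show ?case .
qed

text \<open>Newton's identity with \<open>p\<^sub>k\<close> moved into the sum: as
  \<open>h\<^sub>0 = 1\<close>, it is the summand \<open>i = 0\<close>.\<close>

lemma newton_recursion:
  assumes "zero_insensitive f" "k > 0"
  shows "(\<Sum>i<k. newton (\<lambda>l. f (i # l)) (k - i)) = int k * f [k]"
proof -
  have e: "(\<lambda>l. f (0 # l)) = f" using assms zero_insensitive_head by blast
  have "{..<k} = insert 0 {1..<k}" using assms(2) by auto
  thus ?thesis by (simp add: e newton.simps[of f k])
qed

text \<open>The half of Newton's recursion for a product in which the power sum acts on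
  \<open>f\<close>. For fixed \<open>j = a - i\<close> the sum over \<open>i\<close> is an instance
  of Newton's identity for \<open>f\<close>; the subtracted term is \<open>a = 0\<close>, which the
  recursion omits.\<close>

lemma newton_conv_part:
  assumes f: "zero_insensitive f" and k: "k > 0"
  shows "(\<Sum>a\<in>{1..<k}. \<Sum>i\<le>a. newton (\<lambda>l. f (i # l)) (k - a) * g [a - i])
    = (\<Sum>j<k. int (k - j) * f [k - j] * g [j]) - newton f k * g [0]"
proof -
  let ?n = "\<lambda>i m. newton (\<lambda>l. f (i # l)) m"
  have e: "(\<lambda>l. f (0 # l)) = f" using f zero_insensitive_head by blast
  have "(\<Sum>a\<in>{..<k}. \<Sum>i\<le>a. ?n i (k - a) * g [a - i]) = (\<Sum>j<k. \<Sum>i<k - j. ?n i (k - j - i) * g [j])"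
    by (subst sum.Sigma, simp, simp, subst sum.Sigma, simp, simp,
      rule sum.reindex_bij_witness[of _ "\<lambda>(j, i). (j + i, i)" "\<lambda>(a, i). (a - i, i)"]) auto
  also have "\<dots> = (\<Sum>j<k. int (k - j) * f [k - j] * g [j])"
    by (intro sum.cong refl, subst sum_distrib_right[symmetric], subst newton_recursion[OF f]) auto
  finally have "(\<Sum>a\<in>{..<k}. \<Sum>i\<le>a. ?n i (k - a) * g [a - i]) = (\<Sum>j<k. int (k - j) * f [k - j] * g [j])" .
  moreover have "{..<k} = insert 0 {1..<k}" using k by auto
  ultimately show ?thesis by (simp add: e)
qed

text \<open>Primitivity of \<open>p\<^sub>k\<close>: by induction, the Leibniz rule for the indices
  \<open>k - a\<close> splits the recursion into two halves of the preceding kind.\<close>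

lemma newton_conv:
  assumes "zero_insensitive f" "zero_insensitive g" "k > 0"
  shows "newton (\<lambda>l. conv l f g) k = newton f k * g [] + f [] * newton g k"
  using assms
proof (induction k arbitrary: f g rule: less_induct)
  case (less k)
  note f = less.prems(1) and g = less.prems(2) and k = less.prems(3)
  have z: "f [0] = f []" "g [0] = g []" using f g zero_insensitive_head by blast+
  have "newton (\<lambda>l. conv (a # l) f g) (k - a)
      = (\<Sum>i\<le>a. newton (\<lambda>l. f (i # l)) (k - a) * g [a - i]) + (\<Sum>i\<le>a. newton (\<lambda>l. g (i # l)) (k - a) * f [a - i])"
    if "a \<in> {1..<k}" for a
  proof -
    have "newton (\<lambda>l. conv (a # l) f g) (k - a)
      = (\<Sum>i\<le>a. newton (\<lambda>l. f (i # l)) (k - a) * g [a - i] + f [i] * newton (\<lambda>l. g ((a - i) # l)) (k - a))"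
      using that f g by (simp add: newton_sum less.IH zero_insensitive_Cons)
    also have "\<dots> = (\<Sum>i\<le>a. newton (\<lambda>l. f (i # l)) (k - a) * g [a - i])
        + (\<Sum>i\<le>a. f [i] * newton (\<lambda>l. g ((a - i) # l)) (k - a))"
      by (rule sum.distrib)
    also have "(\<Sum>i\<le>a. f [i] * newton (\<lambda>l. g ((a - i) # l)) (k - a))
        = (\<Sum>i\<le>a. newton (\<lambda>l. g (i # l)) (k - a) * f [a - i])"
      by (rule sum.reindex_bij_witness[of _ "\<lambda>i. a - i" "\<lambda>i. a - i"]) auto
    finally show ?thesis .
  qed
  hence "newton (\<lambda>l. conv l f g) k = int k * (\<Sum>i\<le>k. f [i] * g [k - i])
      - (\<Sum>a\<in>{1..<k}. (\<Sum>i\<le>a. newton (\<lambda>l. f (i # l)) (k - a) * g [a - i])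
          + (\<Sum>i\<le>a. newton (\<lambda>l. g (i # l)) (k - a) * f [a - i]))"
    by (subst newton.simps) (simp del: conv.simps(2), simp)
  also have "\<dots> = int k * (\<Sum>i\<le>k. f [i] * g [k - i])
      - ((\<Sum>j<k. int (k - j) * f [k - j] * g [j]) + (\<Sum>j<k. int (k - j) * g [k - j] * f [j]))
      + (newton f k * g [] + f [] * newton g k)"
    unfolding sum.distrib newton_conv_part[OF f k] newton_conv_part[OF g k] by (simp add: z)
  \<comment> \<open>Over a common index the two sums have weights \<open>i\<close> and
    \<open>k - i\<close>. These add up to \<open>k\<close> and cancel the leading term of the
    recursion, so only the Leibniz terms stay.\<close>
  also have "(\<Sum>j<k. int (k - j) * f [k - j] * g [j]) = (\<Sum>i\<le>k. int i * (f [i] * g [k - i]))"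
  proof -
    have "(\<Sum>i\<le>k. int i * (f [i] * g [k - i])) = (\<Sum>i\<in>{1..k}. int i * (f [i] * g [k - i]))"
      by (rule sum.mono_neutral_right) (auto simp: Suc_le_eq)
    also have "\<dots> = (\<Sum>j<k. int (k - j) * f [k - j] * g [j])"
      by (rule sum.reindex_bij_witness[of _ "\<lambda>i. k - i" "\<lambda>i. k - i"]) auto
    finally show ?thesis by simp
  qed
  also have "(\<Sum>j<k. int (k - j) * g [k - j] * f [j]) = (\<Sum>i\<le>k. int (k - i) * (f [i] * g [k - i]))"
    by (rule sum.mono_neutral_cong_left) auto
  also have "(\<Sum>i\<le>k. int i * (f [i] * g [k - i])) + (\<Sum>i\<le>k. int (k - i) * (f [i] * g [k - i]))
      = int k * (\<Sum>i\<le>k. f [i] * g [k - i])"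
    unfolding sum.distrib[symmetric] sum_distrib_left
    by (rule sum.cong) (auto simp flip: distrib_right of_nat_add)
  finally show ?case by simp
qed

section \<open>Strips and Kostka numbers\<close>

definition partitions_upto :: "nat \<Rightarrow> (nat \<Rightarrow> nat) set" where
  "partitions_upto n = {\<mu>. antimono \<mu> \<and> (\<forall>i\<ge>n. \<mu> i = 0)}"

text \<open>\<open>\<nu>\<close> is what a horizontal strip removed from \<open>\<mu>\<close>
  leaves. Interlacing makes \<open>\<nu>\<close> weakly decreasing by itself, which
  \<open>vertical\<close> has to demand.\<close>

definition horizontal :: "(nat \<Rightarrow> nat) \<Rightarrow> (nat \<Rightarrow> nat) set" where
  "horizontal \<mu> = {\<nu>. \<forall>i. \<mu> (Suc i) \<le> \<nu> i \<and> \<nu> i \<le> \<mu> i}"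

definition vertical :: "(nat \<Rightarrow> nat) \<Rightarrow> (nat \<Rightarrow> nat) set" where
  "vertical \<mu> = {\<nu>. antimono \<nu> \<and> (\<forall>i. \<nu> i \<le> \<mu> i \<and> \<mu> i \<le> Suc (\<nu> i))}"

lemma finite_below:
  fixes \<mu> :: "nat \<Rightarrow> nat"
  assumes "\<forall>i\<ge>n. \<mu> i = 0"
  shows "finite {\<nu>. \<forall>i. \<nu> i \<le> (\<mu> i :: nat)}"
proof (rule finite_subset)
  let ?b = "sum \<mu> {..<n}"
  show "finite {f. \<forall>x. (x \<in> {..<n} \<longrightarrow> f x \<in> {..?b}) \<and> (x \<notin> {..<n} \<longrightarrow> f x = 0)}"
    by (rule finite_set_of_finite_funs) auto
  have "\<nu> x \<le> ?b" if "\<forall>i. \<nu> i \<le> \<mu> i" "x < n" for \<nu> x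
    using that member_le_sum[of x "{..<n}" \<mu>] by (meson finite_lessThan le_trans lessThan_iff zero_le)
  moreover have "\<nu> x = 0" if "\<forall>i. \<nu> i \<le> \<mu> i" "x \<ge> n" for \<nu> x
    using that assms by (metis le_zero_eq)
  ultimately show "{\<nu>. \<forall>i. \<nu> i \<le> \<mu> i}
      \<subseteq> {f. \<forall>x. (x \<in> {..<n} \<longrightarrow> f x \<in> {..?b}) \<and> (x \<notin> {..<n} \<longrightarrow> f x = 0)}"
    by auto
qed

lemma finite_horizontal: "\<mu> \<in> partitions_upto n \<Longrightarrow> finite (horizontal \<mu>)"
  by (rule finite_subset[OF _ finite_below[of n \<mu>]]) (auto simp: horizontal_def partitions_upto_def)

lemma finite_vertical: "\<mu> \<in> partitions_upto n \<Longrightarrow> finite (vertical \<mu>)"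
  by (rule finite_subset[OF _ finite_below[of n \<mu>]]) (auto simp: vertical_def partitions_upto_def)

lemma horizontal_partition: "\<mu> \<in> partitions_upto n \<Longrightarrow> \<nu> \<in> horizontal \<mu> \<Longrightarrow> \<nu> \<in> partitions_upto n"
  by (auto simp: horizontal_def partitions_upto_def antimono_iff_le_Suc) (meson le_trans, metis le_zero_eq)

lemma vertical_partition: "\<mu> \<in> partitions_upto n \<Longrightarrow> \<nu> \<in> vertical \<mu> \<Longrightarrow> \<nu> \<in> partitions_upto n"
  by (auto simp: vertical_def partitions_upto_def) (metis le_zero_eq)

lemma horizontal_refl: "\<mu> \<in> partitions_upto n \<Longrightarrow> \<mu> \<in> horizontal \<mu>"
  by (auto simp: horizontal_def partitions_upto_def antimono_def)

lemma vertical_refl: "\<mu> \<in> partitions_upto n \<Longrightarrow> \<mu> \<in> vertical \<mu>"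
  by (auto simp: vertical_def partitions_upto_def)

lemma horizontal_sum_le: "\<nu> \<in> horizontal \<mu> \<Longrightarrow> sum \<nu> A \<le> sum \<mu> A"
  by (rule sum_mono) (auto simp: horizontal_def)

lemma vertical_sum_le: "\<nu> \<in> vertical \<mu> \<Longrightarrow> sum \<nu> A \<le> sum \<mu> A"
  by (rule sum_mono) (auto simp: vertical_def)

text \<open>The head of the content list belongs to the largest entry.\<close>

primrec kostka :: "nat \<Rightarrow> nat list \<Rightarrow> (nat \<Rightarrow> nat) \<Rightarrow> int" where
  "kostka n [] \<mu> = (if sum \<mu> {..<n} = 0 then 1 else 0)"
| "kostka n (a # l) \<mu> = (\<Sum>\<nu>\<in>{\<nu> \<in> horizontal \<mu>. sum \<mu> {..<n} = sum \<nu> {..<n} + a}. kostka n l \<nu>)"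

lemma sum_eq_imp_eq:
  assumes "\<mu> \<in> partitions_upto n" "\<And>i. \<nu> i \<le> \<mu> i" "sum \<mu> {..<n} = sum \<nu> {..<n}"
  shows "\<nu> = \<mu>"
proof
  fix i
  have "\<nu> i = \<mu> i" if "i < n"
    using sum_mono_inv[of \<nu> "{..<n}" \<mu> i] assms that by auto
  moreover have "\<nu> i = \<mu> i" if "i \<ge> n"
    using assms(1) assms(2)[of i] that by (auto simp: partitions_upto_def)
  ultimately show "\<nu> i = \<mu> i" by linarith
qed

lemma horizontal_zero:
  assumes "\<mu> \<in> partitions_upto n"
  shows "{\<nu> \<in> horizontal \<mu>. sum \<mu> {..<n} = sum \<nu> {..<n} + 0} = {\<mu>}"
  using sum_eq_imp_eq[OF assms] horizontal_refl[OF assms] by (auto simp: horizontal_def)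

lemma kostka_zero_insensitive:
  "\<mu> \<in> partitions_upto n \<Longrightarrow> zero_insensitive (\<lambda>l. kostka n (l @ m) \<mu>)"
proof -
  have "kostka n (p @ 0 # l) \<mu> = kostka n (p @ l) \<mu>" if "\<mu> \<in> partitions_upto n" for p l
    using that
  proof (induction p arbitrary: \<mu>)
    case Nil
    thus ?case by (simp only: append_Nil kostka.simps horizontal_zero) simp
  next
    case (Cons a p)
    thus ?case using horizontal_partition by (auto intro!: sum.cong)
  qed
  thus "\<mu> \<in> partitions_upto n \<Longrightarrow> ?thesis" by (simp add: zero_insensitive_def)
qed

text \<open>The strips \<open>\<kappa>\<close> cancel in pairs: the last row in which \<open>\<nu>\<close> and \<open>\<mu>\<close> differ may or may not be
  lengthened.\<close>

lemma alternating_strips: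
  assumes \<mu>: "\<mu> \<in> partitions_upto n" and \<nu>: "\<nu> \<in> partitions_upto n" "\<nu> \<noteq> \<mu>"
  shows "(\<Sum>\<kappa>\<in>{\<kappa> \<in> horizontal \<mu>. \<nu> \<in> vertical \<kappa>}. (-1) ^ (sum \<kappa> {..<n} + sum \<nu> {..<n}) :: int) = 0"
proof (cases "\<forall>i. \<nu> i \<le> \<mu> i")
  case False
  have empty: "{\<kappa> \<in> horizontal \<mu>. \<nu> \<in> vertical \<kappa>} = {}"
  proof (rule ccontr)
    assume "\<not> ?thesis"
    then obtain \<kappa> where "\<kappa> \<in> horizontal \<mu>" "\<nu> \<in> vertical \<kappa>" by blast
    hence "\<nu> i \<le> \<kappa> i" "\<kappa> i \<le> \<mu> i" for i
      by (simp_all add: horizontal_def vertical_def)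
    hence "\<forall>i. \<nu> i \<le> \<mu> i" using le_trans by blast
    thus False using False by simp
  qed
  show ?thesis unfolding empty by (rule sum.empty)
next
  case True
  define i where "i = Max {i. \<nu> i \<noteq> \<mu> i}"
  have zero: "\<mu> j = 0" "\<nu> j = 0" if "n \<le> j" for j
    using \<mu> \<nu>(1) that by (auto simp: partitions_upto_def)
  have "{i. \<nu> i \<noteq> \<mu> i} \<subseteq> {..<n}"
  proof
    fix j assume "j \<in> {i. \<nu> i \<noteq> \<mu> i}"
    thus "j \<in> {..<n}" using zero[of j] by (cases "n \<le> j") auto
  qed
  hence fin: "finite {i. \<nu> i \<noteq> \<mu> i}" by (rule finite_subset) simp
  moreover have "{i. \<nu> i \<noteq> \<mu> i} \<noteq> {}" using \<nu>(2) by (auto simp: fun_eq_iff)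
  ultimately have "i \<in> {i. \<nu> i \<noteq> \<mu> i}" unfolding i_def by (rule Max_in)
  hence i: "\<nu> i < \<mu> i" using True by (simp add: le_neq_implies_less)
  have "\<nu> (Suc i) = \<mu> (Suc i)"
  proof (rule ccontr)
    assume "\<nu> (Suc i) \<noteq> \<mu> (Suc i)"
    hence "Suc i \<le> i" using Max_ge[OF fin, of "Suc i"] by (simp add: i_def)
    thus False by simp
  qed
  moreover have "\<nu> (Suc i) \<le> \<nu> i" using \<nu>(1) by (simp add: partitions_upto_def antimono_def)
  \<comment> \<open>Hence both \<open>\<nu> i\<close> and \<open>Suc (\<nu> i)\<close> are
    admissible lengths for row \<open>i\<close> of \<open>\<kappa>\<close>.\<close>
  ultimately have i': "\<mu> (Suc i) \<le> \<nu> i" by simp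
  have n: "i < n"
    using i zero(1)[of i] by (cases "n \<le> i") auto
  define t where "t = (\<lambda>\<kappa> :: nat \<Rightarrow> nat. \<kappa>(i := if \<kappa> i = \<nu> i then Suc (\<nu> i) else \<nu> i))"
  let ?C = "{\<kappa> \<in> horizontal \<mu>. \<nu> \<in> vertical \<kappa>}" and ?s = "\<lambda>\<kappa>. (-1) ^ (sum \<kappa> {..<n} + sum \<nu> {..<n}) :: int"
  have two: "\<kappa> i = \<nu> i \<or> \<kappa> i = Suc (\<nu> i)" if "\<kappa> \<in> ?C" for \<kappa>
    using that by (auto simp: vertical_def le_Suc_eq intro: antisym)
  have tC: "t \<kappa> \<in> ?C" if "\<kappa> \<in> ?C" for \<kappa>
    using that i i' by (auto simp: t_def horizontal_def vertical_def)
  have tt: "t (t \<kappa>) = \<kappa>" if "\<kappa> \<in> ?C" for \<kappa>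
    using two[OF that] by (auto simp: t_def)
  have sgn: "?s (t \<kappa>) = - ?s \<kappa>" if "\<kappa> \<in> ?C" for \<kappa>
    using two[OF that] n by (auto simp: t_def sum.remove[of "{..<n}" i] cong: sum.cong_simp)
  have "sum ?s ?C = (\<Sum>\<kappa>\<in>?C. - ?s \<kappa>)"
    by (rule sum.reindex_bij_witness[of _ t t]) (use tC tt sgn in auto)
  thus ?thesis by (simp add: sum_negf)
qed

text \<open>The operator form of
  \<open>(\<Sum>j. (-1)\<^sup>j e\<^sub>j) (\<Sum>i. h\<^sub>i) = 1\<close>. After exchanging the
  sums, the factor of each \<open>g \<nu>\<close> is an alternating sum over strips, which leaves
  only \<open>\<nu> = \<mu>\<close>.\<close>

lemma horizontal_vertical_cancel:
  fixes g :: "(nat \<Rightarrow> nat) \<Rightarrow> int"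
  assumes \<mu>: "\<mu> \<in> partitions_upto n"
  shows "(\<Sum>\<kappa>\<in>horizontal \<mu>. \<Sum>\<nu>\<in>vertical \<kappa>. (-1) ^ (sum \<kappa> {..<n} + sum \<nu> {..<n}) * g \<nu>) = g \<mu>"
proof -
  let ?s = "\<lambda>\<kappa> \<nu>. (-1) ^ (sum \<kappa> {..<n} + sum \<nu> {..<n}) :: int"
  let ?B = "{\<nu> \<in> partitions_upto n. \<forall>i. \<nu> i \<le> \<mu> i}"
  have B: "finite ?B"
    by (rule finite_subset[OF _ finite_below[of n \<mu>]]) (use \<mu> in \<open>auto simp: partitions_upto_def\<close>)
  have V: "vertical \<kappa> = {\<nu> \<in> ?B. \<nu> \<in> vertical \<kappa>}" if "\<kappa> \<in> horizontal \<mu>" for \<kappa>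
    using that horizontal_partition[OF \<mu> that] vertical_partition
    by (auto simp: horizontal_def vertical_def intro: le_trans)
  have "(\<Sum>\<kappa>\<in>horizontal \<mu>. \<Sum>\<nu>\<in>vertical \<kappa>. ?s \<kappa> \<nu> * g \<nu>)
      = (\<Sum>\<kappa>\<in>horizontal \<mu>. \<Sum>\<nu> | \<nu> \<in> ?B \<and> \<nu> \<in> vertical \<kappa>. ?s \<kappa> \<nu> * g \<nu>)"
    using V by (intro sum.cong) auto
  also have "\<dots> = (\<Sum>\<nu>\<in>?B. \<Sum>\<kappa> | \<kappa> \<in> horizontal \<mu> \<and> \<nu> \<in> vertical \<kappa>. ?s \<kappa> \<nu> * g \<nu>)"
    by (rule sum.swap_restrict[OF finite_horizontal[OF \<mu>] B])
  also have "\<dots> = (\<Sum>\<nu>\<in>?B. (\<Sum>\<kappa> | \<kappa> \<in> horizontal \<mu> \<and> \<nu> \<in> vertical \<kappa>. ?s \<kappa> \<nu>) * g \<nu>)"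
    by (simp only: sum_distrib_right)
  also have "\<dots> = (\<Sum>\<nu>\<in>{\<mu>}. (\<Sum>\<kappa> | \<kappa> \<in> horizontal \<mu> \<and> \<nu> \<in> vertical \<kappa>. ?s \<kappa> \<nu>) * g \<nu>)"
    using B \<mu> alternating_strips[OF \<mu>] by (intro sum.mono_neutral_right) auto
  also have "\<dots> = (\<Sum>\<kappa> | \<kappa> \<in> horizontal \<mu> \<and> \<mu> \<in> vertical \<kappa>. ?s \<kappa> \<mu>) * g \<mu>"
    by simp
  also have "{\<kappa> \<in> horizontal \<mu>. \<mu> \<in> vertical \<kappa>} = {\<mu>}"
    using horizontal_refl[OF \<mu>] vertical_refl[OF \<mu>]
    by (auto simp: horizontal_def vertical_def intro!: ext antisym)
  finally show ?thesis by simp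
qed

text \<open>The adjoint of \<open>p\<^sub>k = (\<Sum>i + j = k. (-1)\<^sup>i j e\<^sub>i
  h\<^sub>j)\<close>, a form of the Murnaghan-Nakayama rule before cancellation: a vertical strip is
  removed with a sign, then a horizontal one weighted by its size.\<close>

lemma newton_kostka:
  assumes "\<mu> \<in> partitions_upto n" "k > 0"
  shows "newton (\<lambda>z. kostka n (z @ m) \<mu>) k =
    (\<Sum>\<nu>\<in>vertical \<mu>. (-1) ^ (sum \<mu> {..<n} + sum \<nu> {..<n}) *
      (\<Sum>\<rho>\<in>{\<rho> \<in> horizontal \<nu>. sum \<mu> {..<n} = sum \<rho> {..<n} + k}.
        (int (sum \<nu> {..<n}) - int (sum \<rho> {..<n})) * kostka n m \<rho>))"
  using assms
proof (induction k arbitrary: \<mu> rule: less_induct)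
  case (less k)
  note \<mu> = less.prems(1)
  let ?z = "\<lambda>\<mu>. sum \<mu> {..<n}"
  \<comment> \<open>Prescribing the size of \<open>\<rho>\<close> through \<open>M\<close>, not the
    number of removed boxes, makes the induction hypothesis for \<open>k - a\<close> read
    \<open>h \<kappa>\<close> without \<open>a\<close>, so that the sums over \<open>a\<close> and
    \<open>\<kappa>\<close> merge.\<close>
  define g where "g M \<nu> = (\<Sum>\<rho>\<in>{\<rho> \<in> horizontal \<nu>. M = ?z \<rho> + k}.
      (int (?z \<nu>) - int (?z \<rho>)) * kostka n m \<rho>)" for M \<nu>
  define h where "h \<kappa> = (\<Sum>\<nu>\<in>vertical \<kappa>. (-1) ^ (?z \<kappa> + ?z \<nu>) * g (?z \<mu>) \<nu>)" for \<kappa>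
  let ?H = "horizontal \<mu>"
  have fin: "finite ?H" by (rule finite_horizontal[OF \<mu>])
  have IH: "newton (\<lambda>z. kostka n (z @ m) \<kappa>) (k - a) = h \<kappa>"
    if "a \<in> {1..<k}" "\<kappa> \<in> ?H" "?z \<mu> = ?z \<kappa> + a" for a \<kappa>
  proof -
    have "(?z \<kappa> = ?z \<rho> + (k - a)) = (?z \<mu> = ?z \<rho> + k)" for \<rho>
      using that by auto
    thus ?thesis
      using that less.IH[of "k - a" \<kappa>] horizontal_partition[OF \<mu> that(2)] by (simp add: h_def g_def)
  qed
  \<comment> \<open>Strips of \<open>k\<close> or more boxes lie outside the recursion but may be
    included: the sizes of \<open>\<nu>\<close> and \<open>\<rho>\<close> are then forced to agree,
    and the weight vanishes.\<close>
  have h0: "h \<kappa> = 0" if "\<kappa> \<in> ?H" "?z \<kappa> + k \<le> ?z \<mu>" for \<kappa>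
  proof -
    have "?z \<nu> = ?z \<rho>"
      if "\<nu> \<in> vertical \<kappa>" "\<rho> \<in> horizontal \<nu>" "?z \<mu> = ?z \<rho> + k" for \<nu> \<rho>
      using vertical_sum_le[OF that(1), of "{..<n}"] horizontal_sum_le[OF that(2), of "{..<n}"]
        that(3) \<open>?z \<kappa> + k \<le> ?z \<mu>\<close> by linarith
    hence "g (?z \<mu>) \<nu> = 0" if "\<nu> \<in> vertical \<kappa>" for \<nu>
      using that unfolding g_def by (intro sum.neutral ballI) (simp del: of_nat_sum)
    thus ?thesis by (simp add: h_def)
  qed
  have "(\<Sum>a\<in>{1..<k}. newton (\<lambda>z. kostka n ((a # z) @ m) \<mu>) (k - a))
      = (\<Sum>a\<in>{1..<k}. \<Sum>\<kappa> | \<kappa> \<in> ?H \<and> ?z \<mu> = ?z \<kappa> + a. h \<kappa>)"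
    using IH by (simp add: newton_sum)
  also have "\<dots> = (\<Sum>\<kappa>\<in>?H. \<Sum>a | a \<in> {1..<k} \<and> ?z \<mu> = ?z \<kappa> + a. h \<kappa>)"
    by (rule sum.swap_restrict) (simp_all add: fin)
  also have "\<dots> = (\<Sum>\<kappa>\<in>?H - {\<mu>}. h \<kappa>)"
  proof -
    have inner: "(\<Sum>a | a \<in> {1..<k} \<and> ?z \<mu> = ?z \<kappa> + a. h \<kappa>) = (if \<kappa> = \<mu> then 0 else h \<kappa>)"
      if "\<kappa> \<in> ?H" for \<kappa>
    proof -
      have le: "?z \<kappa> \<le> ?z \<mu>" using horizontal_sum_le[OF that] .
      have "{a \<in> {1..<k}. ?z \<mu> = ?z \<kappa> + a}
          = (if ?z \<mu> = ?z \<kappa> \<or> ?z \<kappa> + k \<le> ?z \<mu> then {} else {?z \<mu> - ?z \<kappa>})"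
        using le by auto
      moreover have "\<kappa> = \<mu>" if "?z \<mu> = ?z \<kappa>"
        using sum_eq_imp_eq[OF \<mu> _ that] \<open>\<kappa> \<in> ?H\<close> by (simp add: horizontal_def)
      ultimately show ?thesis using h0[OF that] less.prems(2) by auto
    qed
    have "(\<Sum>\<kappa>\<in>?H. \<Sum>a | a \<in> {1..<k} \<and> ?z \<mu> = ?z \<kappa> + a. h \<kappa>) = (\<Sum>\<kappa>\<in>?H. if \<kappa> = \<mu> then 0 else h \<kappa>)"
      by (rule sum.cong[OF refl inner])
    also have "\<dots> = (\<Sum>\<kappa>\<in>?H - {\<mu>}. h \<kappa>)"
      by (rule sum.mono_neutral_cong_right) (auto simp: fin)
    finally show ?thesis .
  qed
  also have "\<dots> = (\<Sum>\<kappa>\<in>?H. h \<kappa>) - h \<mu>"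
    using fin horizontal_refl[OF \<mu>] by (simp add: sum_diff1)
  \<comment> \<open>With \<open>\<kappa> = \<mu>\<close> included the strips cancel. In
    \<open>g\<close> at \<open>\<mu>\<close> every weight is \<open>k\<close>, which gives the
    leading term of Newton's recursion.\<close>
  also have "(\<Sum>\<kappa>\<in>?H. h \<kappa>) = g (?z \<mu>) \<mu>"
    unfolding h_def by (rule horizontal_vertical_cancel[OF \<mu>])
  also have "\<dots> = int k * kostka n ([k] @ m) \<mu>"
    by (simp add: g_def sum_distrib_left)
  finally have "newton (\<lambda>z. kostka n (z @ m) \<mu>) k = h \<mu>"
    by (subst newton.simps) (simp del: kostka.simps)
  thus ?case by (simp add: h_def g_def)
qed

section \<open>Triangularity of Kostka numbers\<close>

text \<open>Columns increase strictly, so the rows from \<open>i\<close> on contain only letters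
  from \<open>i\<close> on; with the largest letter first, these are the initial
  \<open>length l - i\<close> entries of \<open>l\<close>. The induction removes the largest letter,
  of which at most \<open>a\<close> boxes lie in those rows.\<close>

lemma kostka_tail_sums:
  assumes "\<mu> \<in> partitions_upto n" "kostka n l \<mu> \<noteq> 0" "length l \<le> n"
  shows "sum \<mu> {i..<n} \<le> sum_list (take (length l - i) l)"
  using assms
proof (induction l arbitrary: \<mu> i)
  case Nil
  hence "sum \<mu> {..<n} = 0" by (simp split: if_splits)
  thus ?case by (simp add: lessThan_atLeast0)
next
  case (Cons a l)
  from Cons.prems(2) obtain \<nu> where \<nu>: "\<nu> \<in> horizontal \<mu>" "sum \<mu> {..<n} = sum \<nu> {..<n} + a" "kostka n l \<nu> \<noteq> 0"
    by (auto elim!: sum.not_neutral_contains_not_neutral)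
  have IH: "sum \<nu> {j..<n} \<le> sum_list (take (length l - j) l)" for j
    using Cons.IH[OF horizontal_partition[OF Cons.prems(1) \<nu>(1)] \<nu>(3)] Cons.prems(3) by simp
  show ?case
  proof (cases "i \<le> length l")
    case True
    have "sum \<mu> {..<n} = sum \<mu> {..<i} + sum \<mu> {i..<n}" "sum \<nu> {..<n} = sum \<nu> {..<i} + sum \<nu> {i..<n}"
      using True Cons.prems(3) by (simp_all add: lessThan_atLeast0 sum.atLeastLessThan_concat)
    hence "sum \<mu> {i..<n} \<le> sum \<nu> {i..<n} + a"
      using \<nu>(2) horizontal_sum_le[OF \<nu>(1), of "{..<i}"] by linarith
    also have "\<dots> \<le> sum_list (take (length (a # l) - i) (a # l))"
      using IH[of i] True by (simp add: Suc_diff_le)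
    finally show ?thesis .
  next
    \<comment> \<open>All letters are smaller than \<open>i\<close>, so the rows from
      \<open>i\<close> on must be empty; interlacing bounds them by the rows of \<open>\<nu>\<close>
      from \<open>i - 1\<close> on.\<close>
    case False
    then obtain j where j: "i = Suc j" "length l \<le> j" by (cases i) auto
    have "sum \<mu> {i..<n} = sum \<mu> {Suc j..<Suc n}"
      using Cons.prems(1) j by (cases "i \<le> n") (auto simp: partitions_upto_def)
    also have "\<dots> = sum (\<lambda>i. \<mu> (Suc i)) {j..<n}" by (rule sum.shift_bounds_Suc_ivl)
    also have "\<dots> \<le> sum \<nu> {j..<n}" using \<nu>(1) by (intro sum_mono) (auto simp: horizontal_def)
    also have "\<dots> \<le> 0" using IH[of j] j by simp
    finally show ?thesis by simp
  qed
qed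

definition truncation :: "nat \<Rightarrow> (nat \<Rightarrow> nat) \<Rightarrow> nat \<Rightarrow> nat" where
  "truncation m \<mu> i = (if i < m then \<mu> i else 0)"

text \<open>Rows are peeled off from the bottom: the tail sums for the smaller letters leave no
  boxes in row \<open>m\<close>, so the letter \<open>m\<close> must fill exactly that row.\<close>

lemma kostka_truncation:
  assumes "\<mu> \<in> partitions_upto n" "m \<le> n"
  shows "kostka n (rev (map \<mu> [0..<m])) (truncation m \<mu>) = 1"
  using assms(2)
proof (induction m)
  case 0
  thus ?case by (simp add: truncation_def)
next
  case (Suc m)
  let ?t = "truncation (Suc m) \<mu>" and ?u = "truncation m \<mu>"
  have P: "truncation k \<mu> \<in> partitions_upto n" for k
    using assms(1) by (auto simp: truncation_def partitions_upto_def antimono_def)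
  let ?N = "{\<nu> \<in> horizontal ?t. sum ?t {..<n} = sum \<nu> {..<n} + \<mu> m}"
  have tu: "sum ?t {..<n} = sum ?u {..<n} + \<mu> m"
  proof -
    have "?t = ?u(m := \<mu> m)" by (auto simp: truncation_def)
    hence "sum ?t {..<n} = \<mu> m + sum ?u ({..<n} - {m})"
      using Suc.prems by (simp add: sum.remove[of _ m])
    also have "sum ?u ({..<n} - {m}) = sum ?u {..<n}"
      by (rule sum.mono_neutral_left) (auto simp: truncation_def)
    finally show ?thesis by simp
  qed
  have u: "?u \<in> ?N"
    using tu assms(1) by (auto simp: horizontal_def truncation_def partitions_upto_def antimono_def)
  have "kostka n (rev (map \<mu> [0..<m])) \<nu> = 0" if "\<nu> \<in> ?N - {?u}" for \<nu>
  proof (rule ccontr)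
    assume nz: "kostka n (rev (map \<mu> [0..<m])) \<nu> \<noteq> 0"
    have h: "\<nu> \<in> horizontal ?t" using that by simp
    have "sum \<nu> {m..<n} = 0"
      using kostka_tail_sums[OF horizontal_partition[OF P h] nz, of m] Suc.prems by simp
    hence "\<nu> i = 0" if "m \<le> i" for i
      using that horizontal_partition[OF P h] by (cases "i < n") (auto simp: partitions_upto_def)
    hence le: "\<nu> i \<le> ?u i" for i
      using h by (auto simp: horizontal_def truncation_def) (metis less_SucI)
    have "sum ?u {..<n} = sum \<nu> {..<n}" using that tu by simp
    hence "\<nu> = ?u" by (rule sum_eq_imp_eq[OF P le])
    thus False using that by simp
  qed
  hence "(\<Sum>\<nu>\<in>?N. kostka n (rev (map \<mu> [0..<m])) \<nu>) = (\<Sum>\<nu>\<in>{?u}. kostka n (rev (map \<mu> [0..<m])) \<nu>)"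
    using u finite_horizontal[OF P] by (intro sum.mono_neutral_right) auto
  thus ?case using Suc by simp
qed

lemma kostka_diagonal:
  "\<mu> \<in> partitions_upto n \<Longrightarrow> kostka n (rev (map \<mu> [0..<n])) \<mu> = 1"
proof -
  assume \<mu>: "\<mu> \<in> partitions_upto n"
  hence "truncation n \<mu> = \<mu>" by (auto simp: truncation_def partitions_upto_def)
  thus ?thesis using kostka_truncation[OF \<mu> order_refl] by simp
qed

lemma sum_list_take_rev_map:
  "sum_list (take (n - i) (rev (map f [0..<n]))) = sum f {i..<n}"
  by (cases "i \<le> n") (simp_all add: take_rev drop_map sum_list_rev interv_sum_list_conv_sum_set_nat)

lemma list_eq_by_partial_sums:
  fixes p q :: "nat list"
  assumes "length p = n" "length q = n" "\<And>i. sum_list (take (n - i) p) = sum_list (take (n - i) q)"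
  shows "p = q"
proof (rule nth_equalityI)
  fix j assume j: "j < length p"
  have e: "sum_list (take t p) = sum_list (take t q)" if "t \<le> n" for t
    using assms(3)[of "n - t"] that by simp
  show "p ! j = q ! j"
    using e[of j] e[of "Suc j"] j assms(1,2) by (simp add: take_Suc_conv_app_nth)
qed (simp add: assms)

section \<open>Decompositions of a content into two\<close>

definition list_splits :: "nat list \<Rightarrow> (nat list \<times> nat list) set" where
  "list_splits m = {(p, q). length p = length m \<and> length q = length m \<and> map2 (+) p q = m}"

lemma list_splits_Nil: "list_splits [] = {([], [])}"
  by (auto simp: list_splits_def)

lemma list_splits_Cons:
  "list_splits (a # m) = (\<lambda>(i, p, q). (i # p, (a - i) # q)) ` ({..a} \<times> list_splits m)"
proof (intro subset_antisym subsetI)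
  fix x assume "x \<in> list_splits (a # m)"
  then obtain p q where x: "x = (p, q)" and "length p = Suc (length m)" "length q = Suc (length m)"
    and s: "map2 (+) p q = a # m"
    by (auto simp: list_splits_def)
  then obtain i p' j q' where pq: "p = i # p'" "q = j # q'" "length p' = length m" "length q' = length m"
    by (auto simp: length_Suc_conv)
  hence "a = i + j" "map2 (+) p' q' = m" using s by simp_all
  hence "(i, p', q') \<in> {..a} \<times> list_splits m" "x = (\<lambda>(i, p, q). (i # p, (a - i) # q)) (i, p', q')"
    using x pq by (simp_all add: list_splits_def)
  thus "x \<in> (\<lambda>(i, p, q). (i # p, (a - i) # q)) ` ({..a} \<times> list_splits m)" by (rule rev_image_eqI)
next
  fix x assume "x \<in> (\<lambda>(i, p, q). (i # p, (a - i) # q)) ` ({..a} \<times> list_splits m)"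
  then obtain i p q where "i \<le> a" "(p, q) \<in> list_splits m" "x = (i # p, (a - i) # q)" by auto
  thus "x \<in> list_splits (a # m)" by (simp add: list_splits_def)
qed

lemma finite_list_splits: "finite (list_splits m)"
  by (induction m) (auto simp: list_splits_Nil list_splits_Cons)

lemma list_splits_sum_list_take:
  "(p, q) \<in> list_splits m \<Longrightarrow> sum_list (take t p) + sum_list (take t q) = sum_list (take t m)"
proof (induction m arbitrary: p q t)
  case (Cons a m)
  thus ?case by (cases t) (fastforce simp: list_splits_Cons)+
qed (simp add: list_splits_Nil)

lemma conv_list_splits: "conv m f g = (\<Sum>(p, q)\<in>list_splits m. f p * g q)"
proof (induction m arbitrary: f g)
  case (Cons a m)
  have inj: "inj_on (\<lambda>(i, p, q). (i # p, (a - i) # q)) ({..a} \<times> list_splits m)"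
    by (auto simp: inj_on_def)
  show ?case
    unfolding list_splits_Cons sum.reindex[OF inj]
    by (simp add: Cons.IH sum.cartesian_product case_prod_unfold)
qed (simp add: list_splits_Nil)

text \<open>Distributing the suffix \<open>m\<close> over both factors in all ways leaves
  convolutions in the prefix \<open>z\<close>, to which the Leibniz rule for \<open>newton\<close>
  applies.\<close>

lemma conv_append:
  "conv (z @ m) f g = (\<Sum>(p, q)\<in>list_splits m. conv z (\<lambda>z. f (z @ p)) (\<lambda>z. g (z @ q)))"
proof (induction z arbitrary: f g)
  case Nil
  show ?case by (simp add: conv_list_splits list_splits_Nil)
next
  case (Cons a z)
  have "conv ((a # z) @ m) f g = (\<Sum>i\<le>a. \<Sum>(p, q)\<in>list_splits m.
      conv z (\<lambda>z. f (i # z @ p)) (\<lambda>z. g ((a - i) # z @ q)))"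
    by (simp add: Cons.IH)
  also have "\<dots> = (\<Sum>(p, q)\<in>list_splits m. conv (a # z) (\<lambda>z. f (z @ p)) (\<lambda>z. g (z @ q)))"
    by (subst sum.swap) (simp add: case_prod_unfold)
  finally show ?case .
qed

section \<open>Branching of semistandard tableaux\<close>

text \<open>The head carries the variable of largest index, so prepending a letter leaves the other
  exponents in place, as in \<open>kostka\<close>.\<close>

primrec list_monomial :: "nat list \<Rightarrow> monomial" where
  "list_monomial [] = 0"
| "list_monomial (a # l) = list_monomial l + Poly_Mapping.single (length l) a"

lemma lookup_list_monomial_ge: "length l \<le> i \<Longrightarrow> Poly_Mapping.lookup (list_monomial l) i = 0"
  by (induction l) (simp_all add: lookup_add lookup_single)

lemma lookup_list_monomial_Cons:
  "Poly_Mapping.lookup (list_monomial (a # l)) = (Poly_Mapping.lookup (list_monomial l))(length l := a)"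
  by (auto simp: fun_eq_iff lookup_add lookup_single lookup_list_monomial_ge)

lemma card_diagram: "\<mu> \<in> partitions_upto n \<Longrightarrow> card (diagram \<mu>) = sum \<mu> {..<n}"
proof -
  assume "\<mu> \<in> partitions_upto n"
  hence "diagram \<mu> = Sigma {..<n} (\<lambda>i. {..<\<mu> i})"
    by (auto simp: diagram_def partitions_upto_def) (metis leI less_nat_zero_code)
  thus ?thesis by simp
qed

lemma finite_support_nat:
  fixes w :: "nat \<Rightarrow> nat"
  assumes "\<And>k. L \<le> k \<Longrightarrow> w k = 0"
  shows "finite {k. w k \<noteq> 0}"
proof (rule finite_subset)
  show "{k. w k \<noteq> 0} \<subseteq> {..<L}"
  proof
    fix k assume "k \<in> {k. w k \<noteq> 0}"
    thus "k \<in> {..<L}" using assms[of k] by (cases "L \<le> k") auto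
  qed
qed simp

lemma partitions_upto_finite_support: "\<mu> \<in> partitions_upto n \<Longrightarrow> finite {i. \<mu> i \<noteq> 0}"
  by (rule finite_support_nat[of n]) (simp add: partitions_upto_def)

lemma content_entry_nonzero:
  assumes "\<mu> \<in> partitions_upto n" "j < \<mu> i"
  shows "content \<mu> T (T i j) \<noteq> 0"
proof -
  define A where "A = {(i', j') \<in> diagram \<mu>. T i' j' = T i j}"
  have "finite A"
    by (rule finite_subset[OF _ finite_diagram[OF partitions_upto_finite_support[OF assms(1)]]])
      (auto simp: A_def)
  moreover have "(i, j) \<in> A" using assms(2) by (simp add: A_def diagram_def)
  ultimately have "card A \<noteq> 0" by auto
  thus ?thesis by (simp add: content_def A_def)
qed

definition adjoin_letter :: "nat \<Rightarrow> (nat \<Rightarrow> nat) \<Rightarrow> (nat \<Rightarrow> nat) \<Rightarrow> (nat \<Rightarrow> nat \<Rightarrow> nat) \<Rightarrow> nat \<Rightarrow> nat \<Rightarrow> nat" where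
  "adjoin_letter L \<mu> \<nu> T i j = (if j < \<nu> i then T i j else if j < \<mu> i then L else 0)"

definition remove_letter :: "nat \<Rightarrow> (nat \<Rightarrow> nat) \<Rightarrow> (nat \<Rightarrow> nat \<Rightarrow> nat) \<Rightarrow> nat \<Rightarrow> nat \<Rightarrow> nat" where
  "remove_letter L \<mu> T i j = (if j < row_count \<mu> T L i then T i j else 0)"

text \<open>By \<open>w\<close> all entries of \<open>T\<close> are below \<open>L\<close>.
  Interlacing puts a box of \<open>\<nu>\<close> above every new box outside the first row, so
  columns stay strict.\<close>

lemma adjoin_letter_ssyt:
  assumes \<mu>: "\<mu> \<in> partitions_upto n" and \<nu>: "\<nu> \<in> horizontal \<mu>" "sum \<mu> {..<n} = sum \<nu> {..<n} + a"
    and T: "T \<in> ssyt_with_content \<nu> w" and w: "\<And>k. L \<le> k \<Longrightarrow> w k = 0"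
  shows "adjoin_letter L \<mu> \<nu> T \<in> ssyt_with_content \<mu> (w(L := a))"
    "row_count \<mu> (adjoin_letter L \<mu> \<nu> T) L = \<nu>"
    "remove_letter L \<mu> (adjoin_letter L \<mu> \<nu> T) = T"
proof -
  let ?F = "adjoin_letter L \<mu> \<nu> T"
  note \<nu>P = horizontal_partition[OF \<mu> \<nu>(1)]
  have le: "\<nu> i \<le> \<mu> i" "\<mu> (Suc i) \<le> \<nu> i" for i using \<nu>(1) by (simp_all add: horizontal_def)
  have Ts: "T \<in> ssyt \<nu>" and Tc: "content \<nu> T = w" using T by (simp_all add: ssyt_with_content_def)
  have lt: "T i j < L" if "j < \<nu> i" for i j
    using content_entry_nonzero[OF \<nu>P that, of T] w[of "T i j"] Tc by (metis not_le)
  have row: "?F i j \<le> ?F i (Suc j)" if "Suc j < \<mu> i" for i j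
  proof (cases "Suc j < \<nu> i")
    case True
    thus ?thesis using Ts by (simp add: adjoin_letter_def ssyt_def diagram_def)
  next
    case False
    thus ?thesis using that lt[of j i] by (auto simp: adjoin_letter_def intro: less_imp_le)
  qed
  have col: "?F i j < ?F (Suc i) j" if "j < \<mu> (Suc i)" for i j
  proof -
    have j: "j < \<nu> i" using that le(2)[of i] by simp
    show ?thesis
    proof (cases "j < \<nu> (Suc i)")
      case True
      thus ?thesis using Ts j by (simp add: adjoin_letter_def ssyt_def diagram_def)
    next
      case False
      thus ?thesis using j that lt[OF j] by (simp add: adjoin_letter_def)
    qed
  qed
  have out: "?F i j = 0" if "\<not> j < \<mu> i" for i j
    using that le(1)[of i] by (simp add: adjoin_letter_def)
  have S: "?F \<in> ssyt \<mu>" using row col out by (simp add: ssyt_def diagram_def)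
  have ent: "?F i j < L \<longleftrightarrow> j < \<nu> i" if "j < \<mu> i" for i j
    using that lt[of j i] by (simp add: adjoin_letter_def)
  have "content \<mu> ?F c = (w(L := a)) c" for c
  proof -
    consider "c < L" | "c = L" | "L < c" by linarith
    thus ?thesis
    proof cases
      case 1
      have "{(i, j) \<in> diagram \<mu>. ?F i j = c} = {(i, j) \<in> diagram \<nu>. T i j = c}"
        using 1 le(1) less_le_trans by (fastforce simp: adjoin_letter_def diagram_def split: if_splits)
      thus ?thesis using 1 Tc by (auto simp: content_def)
    next
      case 2
      have "{(i, j) \<in> diagram \<mu>. ?F i j = c} = diagram \<mu> - diagram \<nu>"
        using 2 lt by (fastforce simp: adjoin_letter_def diagram_def split: if_splits)
      moreover have "diagram \<nu> \<subseteq> diagram \<mu>" using le(1) less_le_trans by (fastforce simp: diagram_def)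
      ultimately show ?thesis
        using 2 \<nu>(2) card_diagram[OF \<mu>] card_diagram[OF \<nu>P]
          finite_diagram[OF partitions_upto_finite_support[OF \<nu>P]]
        by (simp add: content_def card_Diff_subset)
    next
      case 3
      have none: "{(i, j) \<in> diagram \<mu>. ?F i j = c} = {}"
        using 3 lt by (fastforce simp: adjoin_letter_def diagram_def split: if_splits)
      have "content \<mu> ?F c = 0" unfolding content_def none by simp
      thus ?thesis using 3 w[of c] by simp
    qed
  qed
  thus "?F \<in> ssyt_with_content \<mu> (w(L := a))" using S by (auto simp: ssyt_with_content_def)
  have "j < \<mu> i \<and> ?F i j < L \<longleftrightarrow> j < \<nu> i" for i j
    using ent[of j i] le(1)[of i] by auto
  hence "{j. j < \<mu> i \<and> ?F i j < L} = {..<\<nu> i}" for i by auto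
  thus rc: "row_count \<mu> ?F L = \<nu>" by (simp add: row_count_def fun_eq_iff)
  show "remove_letter L \<mu> ?F = T"
    using Ts unfolding remove_letter_def rc by (auto simp: fun_eq_iff adjoin_letter_def ssyt_def diagram_def)
qed

text \<open>The inverse of \<open>adjoin_letter\<close>: the entries below the largest letter
  \<open>L\<close> occupy the shape \<open>row_count \<mu> T L\<close>, and strict columns allow at
  most one \<open>L\<close> each, which is the interlacing condition.\<close>

lemma remove_letter_ssyt:
  assumes \<mu>: "\<mu> \<in> partitions_upto n" and w: "\<And>k. L \<le> k \<Longrightarrow> w k = 0"
    and T: "T \<in> ssyt_with_content \<mu> (w(L := a))"
  shows "row_count \<mu> T L \<in> horizontal \<mu>" "sum \<mu> {..<n} = sum (row_count \<mu> T L) {..<n} + a"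
    "remove_letter L \<mu> T \<in> ssyt_with_content (row_count \<mu> T L) w"
    "adjoin_letter L \<mu> (row_count \<mu> T L) (remove_letter L \<mu> T) = T"
proof -
  let ?r = "row_count \<mu> T L" and ?R = "remove_letter L \<mu> T"
  have am: "antimono \<mu>" using \<mu> by (simp add: partitions_upto_def)
  have Ts: "T \<in> ssyt \<mu>" and Tc: "content \<mu> T = w(L := a)" using T by (simp_all add: ssyt_with_content_def)
  note rc = row_count_iff[OF am Ts]
  have le: "T i j \<le> L" if "j < \<mu> i" for i j
    using content_entry_nonzero[OF \<mu> that, of T] w[of "T i j"] Tc by (auto split: if_splits) (meson nat_le_linear)
  have "\<mu> (Suc i) \<le> ?r i" for i
  proof -
    \<comment> \<open>As no entry exceeds \<open>L\<close>, the entries below \<open>Suc L\<close>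
      fill the row; comparing adjacent rows then bounds its length by \<open>?r i\<close>.\<close>
    have "row_count \<mu> T (Suc L) (Suc i) = \<mu> (Suc i)"
    proof -
      have "{j. j < \<mu> (Suc i) \<and> T (Suc i) j < Suc L} = {..<\<mu> (Suc i)}" using le by (auto simp: less_Suc_eq_le)
      thus ?thesis by (simp add: row_count_def)
    qed
    thus ?thesis using row_count_Suc_row[OF am Ts, of L i] by simp
  qed
  moreover have rle: "?r i \<le> \<mu> i" for i using rc[of _ L i] by (meson leI less_irrefl)
  ultimately show h: "?r \<in> horizontal \<mu>" by (simp add: horizontal_def)
  note rP = horizontal_partition[OF \<mu> h]
  have sub: "diagram ?r \<subseteq> diagram \<mu>" using rle less_le_trans by (fastforce simp: diagram_def)
  have "{(i, j) \<in> diagram \<mu>. T i j = L} = diagram \<mu> - diagram ?r"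
    using le rc by (auto simp: diagram_def) (meson le_neq_implies_less)
  hence "content \<mu> T L = sum \<mu> {..<n} - sum ?r {..<n}"
    using sub card_diagram[OF \<mu>] card_diagram[OF rP] finite_diagram[OF partitions_upto_finite_support[OF rP]]
    by (simp add: content_def card_Diff_subset)
  thus "sum \<mu> {..<n} = sum ?r {..<n} + a"
    using Tc horizontal_sum_le[OF h, of "{..<n}"] by simp
  have "?R \<in> ssyt ?r"
    unfolding ssyt_def
  proof (intro CollectI conjI allI impI)
    show "?R i j = 0" if "(i, j) \<notin> diagram ?r" for i j
      using that by (simp add: remove_letter_def diagram_def)
    show "?R i j \<le> ?R i (Suc j)" if "(i, Suc j) \<in> diagram ?r" for i j
      using that ssyt_row[OF am Ts, of j "Suc j" i] rle[of i] by (simp add: remove_letter_def diagram_def)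
    show "?R i j < ?R (Suc i) j" if "(Suc i, j) \<in> diagram ?r" for i j
    proof -
      have "j < \<mu> (Suc i)" using that rle[of "Suc i"] by (simp add: diagram_def)
      moreover have "j < ?r i" using calculation h by (auto simp: horizontal_def intro: less_le_trans)
      ultimately show ?thesis
        using that ssyt_col[OF am Ts, of j i] by (simp add: remove_letter_def diagram_def)
    qed
  qed
  moreover have "content ?r ?R c = w c" for c
  proof (cases "c < L")
    case True
    have "{(i, j) \<in> diagram ?r. ?R i j = c} = {(i, j) \<in> diagram \<mu>. T i j = c}"
      using True rc by (auto simp: diagram_def remove_letter_def)
    thus ?thesis using True Tc by (auto simp: content_def dest: fun_cong[of _ _ c])
  next
    case False
    have none: "{(i, j) \<in> diagram ?r. ?R i j = c} = {}"
      using False rc by (auto simp: diagram_def remove_letter_def)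
    have "content ?r ?R c = 0" unfolding content_def none by simp
    thus ?thesis using False w[of c] by simp
  qed
  ultimately show "?R \<in> ssyt_with_content ?r w" by (auto simp: ssyt_with_content_def)
  show "adjoin_letter L \<mu> ?r ?R = T"
  proof (intro ext)
    fix i j
    have "T i j = L" if "\<not> j < ?r i" "j < \<mu> i" using that le[of j i] rc[of j L i] by simp
    moreover have "T i j = 0" if "\<not> j < \<mu> i" using that Ts by (simp add: ssyt_def diagram_def)
    ultimately show "adjoin_letter L \<mu> ?r ?R i j = T i j"
      by (simp add: adjoin_letter_def remove_letter_def)
  qed
qed

lemma card_ssyt_branching:
  assumes \<mu>: "\<mu> \<in> partitions_upto n" and w: "\<And>k. L \<le> k \<Longrightarrow> w k = 0"
  shows "card (ssyt_with_content \<mu> (w(L := a)))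
    = (\<Sum>\<nu>\<in>{\<nu> \<in> horizontal \<mu>. sum \<mu> {..<n} = sum \<nu> {..<n} + a}. card (ssyt_with_content \<nu> w))"
proof -
  let ?N = "{\<nu> \<in> horizontal \<mu>. sum \<mu> {..<n} = sum \<nu> {..<n} + a}"
  let ?S = "Sigma ?N (\<lambda>\<nu>. ssyt_with_content \<nu> w)"
  have fw: "finite {k. w k \<noteq> 0}"
    using w by (rule finite_support_nat)
  have "bij_betw (\<lambda>(\<nu>, T). adjoin_letter L \<mu> \<nu> T) ?S (ssyt_with_content \<mu> (w(L := a)))"
  proof (rule bij_betw_byWitness[where f' = "\<lambda>T. (row_count \<mu> T L, remove_letter L \<mu> T)"])
    show "\<forall>x\<in>?S. (\<lambda>T. (row_count \<mu> T L, remove_letter L \<mu> T)) ((\<lambda>(\<nu>, T). adjoin_letter L \<mu> \<nu> T) x) = x"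
      using adjoin_letter_ssyt(2,3)[OF \<mu> _ _ _ w] by auto
    show "\<forall>T\<in>ssyt_with_content \<mu> (w(L := a)).
        (\<lambda>(\<nu>, T). adjoin_letter L \<mu> \<nu> T) (row_count \<mu> T L, remove_letter L \<mu> T) = T"
      using remove_letter_ssyt(4)[OF \<mu> w] by auto
    show "(\<lambda>(\<nu>, T). adjoin_letter L \<mu> \<nu> T) ` ?S \<subseteq> ssyt_with_content \<mu> (w(L := a))"
      using adjoin_letter_ssyt(1)[OF \<mu> _ _ _ w] by auto
    show "(\<lambda>T. (row_count \<mu> T L, remove_letter L \<mu> T)) ` ssyt_with_content \<mu> (w(L := a)) \<subseteq> ?S"
      using remove_letter_ssyt(1-3)[OF \<mu> w] by auto
  qed
  hence "card (ssyt_with_content \<mu> (w(L := a))) = card ?S" by (simp add: bij_betw_same_card)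
  also have "\<dots> = (\<Sum>\<nu>\<in>?N. card (ssyt_with_content \<nu> w))"
    using finite_horizontal[OF \<mu>] horizontal_partition[OF \<mu>] fw
    by (intro card_SigmaI ballI finite_ssyt_with_content[OF partitions_upto_finite_support fw]) auto
  finally show ?thesis .
qed

text \<open>Induction on the letters, the largest removed first; it carries the results on
  \<open>kostka\<close> over to the coefficients of \<open>schur\<close>.\<close>

lemma card_ssyt_kostka:
  "\<mu> \<in> partitions_upto n \<Longrightarrow>
    int (card (ssyt_with_content \<mu> (Poly_Mapping.lookup (list_monomial l)))) = kostka n l \<mu>"
proof (induction l arbitrary: \<mu>)
  case Nil
  note fin = partitions_upto_finite_support[OF Nil]
  show ?case
  proof (cases "sum \<mu> {..<n} = 0")
    case True
    hence "\<mu> i = 0" for i using Nil by (cases "i < n") (auto simp: partitions_upto_def)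
    hence "diagram \<mu> = {}" by (simp add: diagram_def)
    hence "ssyt_with_content \<mu> (\<lambda>_. 0) = {\<lambda>_ _. 0}"
      by (auto simp: ssyt_with_content_def ssyt_def content_def fun_eq_iff)
    thus ?thesis using True by (simp add: zero_poly_mapping.rep_eq)
  next
    case False
    have "ssyt_with_content \<mu> (\<lambda>_. 0) = {}"
    proof (rule ccontr)
      assume "\<not> ?thesis"
      then obtain T where "content \<mu> T = (\<lambda>_. 0)" by (auto simp: ssyt_with_content_def)
      thus False using sum_content[OF fin, of "{}" T] card_diagram[OF Nil] False by simp
    qed
    thus ?thesis using False by (simp add: zero_poly_mapping.rep_eq)
  qed
next
  case (Cons a l)
  show ?case
    unfolding lookup_list_monomial_Cons
    using Cons.IH horizontal_partition[OF Cons.prems]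
    by (subst card_ssyt_branching[OF Cons.prems lookup_list_monomial_ge]) auto
qed

section \<open>Functionals on tensor products\<close>

text \<open>The action of the integers on an abelian group. Using \<open>of_int\<close> would impose
  \<open>0 \<noteq> 1\<close> on the coefficient ring, which may be the zero ring.\<close>

definition int_scale :: "int \<Rightarrow> 'a::ab_group_add \<Rightarrow> 'a" where
  "int_scale z r = (\<Sum>i<nat z. r) - (\<Sum>i<nat (- z). r)"

lemma int_scale_0 [simp]: "int_scale 0 r = 0"
  and int_scale_1 [simp]: "int_scale 1 r = r"
  and int_scale_minus_1 [simp]: "int_scale (- 1) r = - r"
  by (simp_all add: int_scale_def)

lemma int_scale_add_right: "int_scale z (r + s) = int_scale z r + int_scale z s"
  by (simp add: int_scale_def sum.distrib)

lemma int_scale_plus_1: "int_scale (z + 1) r = int_scale z r + r"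
proof (cases "0 \<le> z")
  case True
  hence "nat (z + 1) = Suc (nat z)" "nat (- z) = 0" "nat (- (z + 1)) = 0" by simp_all
  thus ?thesis by (simp add: int_scale_def)
next
  case False
  hence "nat (- z) = Suc (nat (- (z + 1)))" "nat z = 0" "nat (z + 1) = 0" by simp_all
  thus ?thesis by (simp add: int_scale_def)
qed

lemma int_scale_add_left: "int_scale (x + y) r = int_scale x r + int_scale y r"
proof (induction y rule: int_induct[where k = 0])
  case (step1 i)
  thus ?case using int_scale_plus_1[of "x + i" r] int_scale_plus_1[of i r] by (simp add: add.assoc)
next
  case (step2 i)
  thus ?case using int_scale_plus_1[of "x + (i - 1)" r] int_scale_plus_1[of "i - 1" r]
    by (simp add: algebra_simps)
qed simp

lemma int_scale_diff_left: "int_scale (x - y) r = int_scale x r - int_scale y r"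
  using int_scale_add_left[of "x - y" y r] by (simp add: algebra_simps)

text \<open>An additive functional \<open>L\<close> on \<open>B\<close> induces the functional \<open>a \<otimes> b \<mapsto> L b \<cdot> a\<close> on \<open>A \<otimes> B\<close>; here
  it is only needed on representatives.\<close>

definition induced_functional ::
  "('b \<Rightarrow> int) \<Rightarrow> (('a::ab_group_add, 'b) tensor_key \<Rightarrow>\<^sub>0 int) \<Rightarrow> 'a" where
  "induced_functional L x = (\<Sum>k\<in>Poly_Mapping.keys x.
     int_scale (Poly_Mapping.lookup x k) (case k of Key a b \<Rightarrow> int_scale (L b) a))"

lemma induced_functional_superset:
  assumes "finite S" "Poly_Mapping.keys x \<subseteq> S"
  shows "induced_functional L x = (\<Sum>k\<in>S.
     int_scale (Poly_Mapping.lookup x k) (case k of Key a b \<Rightarrow> int_scale (L b) a))"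
  unfolding induced_functional_def using assms
  by (intro sum.mono_neutral_left) (auto simp: in_keys_iff)

lemma induced_functional_diff:
  "induced_functional L (x - y) = induced_functional L x - induced_functional L y"
proof -
  let ?S = "Poly_Mapping.keys x \<union> Poly_Mapping.keys y"
  have "Poly_Mapping.keys (x - y) \<subseteq> ?S" by (auto simp: in_keys_iff lookup_minus)
  thus ?thesis
    by (simp add: induced_functional_superset[of ?S] lookup_minus int_scale_diff_left sum_subtractf)
qed

lemma induced_functional_0 [simp]: "induced_functional L 0 = 0"
  by (simp add: induced_functional_def)

lemma induced_functional_add:
  "induced_functional L (x + y) = induced_functional L x + induced_functional L y"
  using induced_functional_diff[of L x "0 - y"] induced_functional_diff[of L 0 y] by simp

lemma induced_functional_frag_of [simp]:
  "induced_functional L (frag_of (Key a b)) = int_scale (L b) a"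
  by (simp add: induced_functional_def)

lemma induced_functional_relations:
  assumes L: "\<And>b b'. L (b + b') = L b + L b'"
  shows "x \<in> tensor_relations \<Longrightarrow> induced_functional L x = 0"
  by (induction rule: tensor_relations.induct)
    (simp_all add: induced_functional_diff int_scale_add_right int_scale_add_left L)

text \<open>Turns a relation over an arbitrary ring into one among its coefficients, with integers
  as factors. An integer functional that is a unit on one vector and zero on the others thus kills
  that coefficient over every ring.\<close>

lemma tensor_combination_functional:
  fixes f :: "'i \<Rightarrow> 'b::{comm_ring,comm_monoid_mult}" and c :: "'i \<Rightarrow> 'a::{comm_ring,comm_monoid_mult}"
  assumes L: "\<And>b b'. L (b + b') = L b + L b'"
    and J: "finite J" and zero: "(\<Sum>i\<in>J. pure_tensor (c i) (f i)) = 0"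
  shows "(\<Sum>i\<in>J. int_scale (L (f i)) (c i)) = 0"
proof -
  let ?x = "\<lambda>J. \<Sum>i\<in>J. frag_of (Key (c i) (f i))"
  have "(\<Sum>i\<in>J. pure_tensor (c i) (f i)) = abs_tensor (?x J)"
    using J by (induction J rule: finite_induct)
      (simp_all add: zero_tensor.abs_eq pure_tensor.abs_eq plus_tensor.abs_eq)
  hence "abs_tensor (?x J) = abs_tensor 0" using zero by (simp add: zero_tensor.abs_eq)
  hence "?x J \<in> tensor_relations" by (simp add: tensor.abs_eq_iff tensor_rel_def)
  hence "induced_functional L (?x J) = 0" using induced_functional_relations L by blast
  moreover have "induced_functional L (?x J) = (\<Sum>i\<in>J. int_scale (L (f i)) (c i))"
    using J by (induction J rule: finite_induct) (simp_all add: induced_functional_add)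
  ultimately show ?thesis by simp
qed

section \<open>The derivation on products of Schur functions\<close>

lemma list_monomial_add:
  "length p = length q \<Longrightarrow> list_monomial p + list_monomial q = list_monomial (map2 (+) p q)"
proof (induction p q rule: list_induct2)
  case (Cons a p b q)
  thus ?case by (simp add: single_add add.assoc add.left_commute flip: Cons.IH)
qed simp

lemma list_monomial_inj:
  "length p = length q \<Longrightarrow> list_monomial p = list_monomial q \<Longrightarrow> p = q"
proof (induction p q rule: list_induct2)
  case (Cons a p b q)
  have "Poly_Mapping.lookup (list_monomial (a # p)) (length p)
      = Poly_Mapping.lookup (list_monomial (b # q)) (length p)"
    by (simp only: Cons.prems)
  hence "a = b" using Cons.hyps by (simp del: list_monomial.simps add: lookup_list_monomial_Cons)
  thus ?case using Cons by simp
qed simp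

lemma list_monomial_surj:
  assumes "\<And>i. n \<le> i \<Longrightarrow> Poly_Mapping.lookup m i = 0"
  obtains p where "length p = n" "list_monomial p = m"
proof -
  have "Poly_Mapping.lookup (list_monomial (rev (map f [0..<n]))) i = (if i < n then f i else 0)" for f i
    by (induction n) (auto simp del: list_monomial.simps(2) simp: lookup_list_monomial_Cons)
  hence e: "list_monomial (rev (map (Poly_Mapping.lookup m) [0..<n])) = m"
    using assms by (intro poly_mapping_eqI) simp
  show ?thesis by (rule that[OF _ e]) simp
qed

lemma list_splits_length:
  "x \<in> list_splits m \<Longrightarrow> length (fst x) = length m \<and> length (snd x) = length m"
  by (cases x) (simp add: list_splits_def)

text \<open>Both factors of a monomial in the first \<open>length l\<close> variables involve only
  these variables, so lists of that length capture all factorizations.\<close>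

lemma splits_list_monomial:
  "bij_betw (map_prod list_monomial list_monomial) (list_splits l) (splits (list_monomial l))"
proof (rule bij_betw_imageI)
  show "inj_on (map_prod list_monomial list_monomial) (list_splits l)"
  proof (rule inj_onI)
    fix x y assume xy: "x \<in> list_splits l" "y \<in> list_splits l"
      and "map_prod list_monomial list_monomial x = map_prod list_monomial list_monomial y"
    hence "list_monomial (fst x) = list_monomial (fst y)" "list_monomial (snd x) = list_monomial (snd y)"
      by (auto simp: map_prod_def case_prod_unfold)
    moreover have "length (fst x) = length (fst y)" "length (snd x) = length (snd y)"
      using xy[THEN list_splits_length] by simp_all
    ultimately show "x = y" using list_monomial_inj by (intro prod_eqI) blast+
  qed
  show "map_prod list_monomial list_monomial ` list_splits l = splits (list_monomial l)"
  proof (intro subset_antisym subsetI)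
    fix x assume "x \<in> map_prod list_monomial list_monomial ` list_splits l"
    then obtain p q where x: "x = (list_monomial p, list_monomial q)" and pq: "(p, q) \<in> list_splits l"
      by auto
    have "length p = length q" "map2 (+) p q = l" using pq by (simp_all add: list_splits_def)
    thus "x \<in> splits (list_monomial l)" by (simp add: x splits_def list_monomial_add)
  next
    fix x assume "x \<in> splits (list_monomial l)"
    then obtain a b where x: "x = (a, b)" and ab: "a + b = list_monomial l"
      by (auto simp: splits_def)
    have "Poly_Mapping.lookup a i = 0 \<and> Poly_Mapping.lookup b i = 0" if "length l \<le> i" for i
      using lookup_list_monomial_ge[OF that] lookup_add[of a b i] ab by simp
    hence "\<exists>p. length p = length l \<and> list_monomial p = a" "\<exists>q. length q = length l \<and> list_monomial q = b"
      using list_monomial_surj[of "length l"] by blast+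
    then obtain p q where p: "length p = length l" "list_monomial p = a"
      and q: "length q = length l" "list_monomial q = b"
      by blast
    have "list_monomial (map2 (+) p q) = list_monomial l"
      using ab p q by (simp flip: list_monomial_add)
    hence "map2 (+) p q = l" using p q by (intro list_monomial_inj) simp_all
    hence "(p, q) \<in> list_splits l" using p q by (simp add: list_splits_def)
    thus "x \<in> map_prod list_monomial list_monomial ` list_splits l"
      using x p q by force
  qed
qed

lemma sf_coeff_times_list_monomial:
  "sf_coeff (F * G) (list_monomial l) =
    conv l (\<lambda>l. sf_coeff F (list_monomial l)) (\<lambda>l. sf_coeff G (list_monomial l))"
proof -
  have "sf_coeff (F * G) (list_monomial l)
      = (\<Sum>x\<in>splits (list_monomial l). case x of (p, q) \<Rightarrow> sf_coeff F p * sf_coeff G q)"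
    by (simp add: times_symm_fun.rep_eq)
  also have "\<dots> = (\<Sum>x\<in>list_splits l. case map_prod list_monomial list_monomial x of
      (p, q) \<Rightarrow> sf_coeff F p * sf_coeff G q)"
    by (rule sum.reindex_bij_betw[OF splits_list_monomial, symmetric])
  also have "\<dots> = conv l (\<lambda>l. sf_coeff F (list_monomial l)) (\<lambda>l. sf_coeff G (list_monomial l))"
    by (simp add: conv_list_splits case_prod_unfold map_prod_def)
  finally show ?thesis .
qed

lemma sf_coeff_schur_list_monomial:
  "part \<mu> \<in> partitions_upto n \<Longrightarrow> sf_coeff (schur \<mu>) (list_monomial l) = kostka n l (part \<mu>)"
  by (simp add: schur.rep_eq card_ssyt_kostka)

text \<open>The coefficient of \<open>list_monomial m\<close> in
  \<open>p\<^sub>k\<^sup>\<bottom> F\<close>: coefficients at \<open>z @ m\<close> are pairings with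
  a product of complete functions, and \<open>newton\<close> trades the part from \<open>z\<close>
  for \<open>p\<^sub>k\<close>.\<close>

definition newton_functional :: "nat \<Rightarrow> nat list \<Rightarrow> symm_fun \<Rightarrow> int" where
  "newton_functional k m F = newton (\<lambda>z. sf_coeff F (list_monomial (z @ m))) k"

lemma newton_add: "newton (\<lambda>l. f l + g l) k = newton f k + newton g k"
  using newton_sum[of "\<lambda>b. if b then f else g" UNIV k] by (simp add: UNIV_bool add.commute)

lemma newton_functional_add:
  "newton_functional k m (F + G) = newton_functional k m F + newton_functional k m G"
  by (simp add: newton_functional_def plus_symm_fun.rep_eq newton_add)

text \<open>The Leibniz term in which \<open>p\<^sub>k\<^sup>\<bottom>\<close> acts on the factor of
  shape \<open>\<alpha>\<close>. It depends on the order of the pair.\<close>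

definition newton_pairing :: "nat \<Rightarrow> nat \<Rightarrow> nat list \<Rightarrow> (nat \<Rightarrow> nat) \<Rightarrow> (nat \<Rightarrow> nat) \<Rightarrow> int" where
  "newton_pairing n k m \<alpha> \<beta>
    = (\<Sum>(p, q)\<in>list_splits m. newton (\<lambda>z. kostka n (z @ p) \<alpha>) k * kostka n q \<beta>)"

lemma list_splits_swap: "bij_betw prod.swap (list_splits m) (list_splits m)"
proof -
  have swap: "map2 (+) q p = map2 (+) p q" if "length p = length q" for p q :: "nat list"
    using that by (induction p q rule: list_induct2) simp_all
  have "(q, p) \<in> list_splits m" if pq: "(p, q) \<in> list_splits m" for p q
  proof -
    have l: "length p = length m" "length q = length m" "map2 (+) p q = m"
      using pq by (simp_all add: list_splits_def)
    have "map2 (+) q p = m" using swap[of p q] l by simp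
    thus ?thesis using l by (simp add: list_splits_def)
  qed
  thus ?thesis by (intro bij_betw_byWitness[where f' = prod.swap]) auto
qed

lemma newton_functional_schur_times:
  assumes "part \<alpha> \<in> partitions_upto n" "part \<beta> \<in> partitions_upto n" "k > 0"
  shows "newton_functional k m (schur \<alpha> * schur \<beta>)
    = newton_pairing n k m (part \<alpha>) (part \<beta>) + newton_pairing n k m (part \<beta>) (part \<alpha>)"
proof -
  let ?A = "\<lambda>l. kostka n l (part \<alpha>)" and ?B = "\<lambda>l. kostka n l (part \<beta>)"
  note zi = kostka_zero_insensitive[OF assms(1)] kostka_zero_insensitive[OF assms(2)]
  have "newton_functional k m (schur \<alpha> * schur \<beta>)
      = newton (\<lambda>z. \<Sum>x\<in>list_splits m. conv z (\<lambda>z. ?A (z @ fst x)) (\<lambda>z. ?B (z @ snd x))) k"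
    by (simp add: newton_functional_def sf_coeff_times_list_monomial conv_append case_prod_unfold
        sf_coeff_schur_list_monomial[OF assms(1)] sf_coeff_schur_list_monomial[OF assms(2)])
  also have "\<dots> = (\<Sum>x\<in>list_splits m. newton (\<lambda>z. ?A (z @ fst x)) k * ?B (snd x)
      + ?A (fst x) * newton (\<lambda>z. ?B (z @ snd x)) k)"
    by (simp add: newton_sum newton_conv[OF zi assms(3)])
  also have "\<dots> = newton_pairing n k m (part \<alpha>) (part \<beta>)
      + (\<Sum>x\<in>list_splits m. ?A (fst x) * newton (\<lambda>z. ?B (z @ snd x)) k)"
    by (simp add: sum.distrib newton_pairing_def case_prod_unfold)
  also have "(\<Sum>x\<in>list_splits m. ?A (fst x) * newton (\<lambda>z. ?B (z @ snd x)) k)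
      = newton_pairing n k m (part \<beta>) (part \<alpha>)"
    unfolding newton_pairing_def
    by (subst sum.reindex_bij_betw[OF list_splits_swap, symmetric]) (simp add: case_prod_unfold mult.commute)
  finally show ?thesis .
qed

section \<open>The coefficient that isolates one ordered pair\<close>

text \<open>The vertical strip costs each row at most one box, and the horizontal strip leaves row
  \<open>i\<close> at least as long as row \<open>Suc i\<close> was. So nothing smaller than
  \<open>\<mu>\<close> without its full rim can occur.\<close>

lemma newton_kostka_nonzero:
  assumes \<mu>: "\<mu> \<in> partitions_upto n" and "k > 0" "newton (\<lambda>z. kostka n (z @ p) \<mu>) k \<noteq> 0"
  obtains \<rho> where "\<rho> \<in> partitions_upto n" "kostka n p \<rho> \<noteq> 0" "\<And>i. \<mu> (Suc i) \<le> Suc (\<rho> i)"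
proof -
  from assms(3) obtain \<nu> \<rho> where \<nu>: "\<nu> \<in> vertical \<mu>" and \<rho>: "\<rho> \<in> horizontal \<nu>" and nz: "kostka n p \<rho> \<noteq> 0"
    unfolding newton_kostka[OF \<mu> assms(2)]
    by (elim sum.not_neutral_contains_not_neutral) (auto elim!: sum.not_neutral_contains_not_neutral)
  have "\<mu> (Suc i) \<le> Suc (\<rho> i)" for i
  proof -
    have "\<mu> (Suc i) \<le> Suc (\<nu> (Suc i))" using \<nu> by (simp add: vertical_def)
    also have "\<nu> (Suc i) \<le> \<rho> i" using \<rho> by (simp add: horizontal_def)
    finally show ?thesis by simp
  qed
  thus ?thesis
    using that nz horizontal_partition[OF vertical_partition[OF \<mu> \<nu>] \<rho>] by blast
qed

text \<open>The shape left after removing the full rim of \<open>\<alpha>\<close>, a border strip meeting all \<open>n\<close> rows.\<close>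

definition rim_removed :: "nat \<Rightarrow> (nat \<Rightarrow> nat) \<Rightarrow> nat \<Rightarrow> nat" where
  "rim_removed n \<alpha> j = (if Suc j < n then \<alpha> (Suc j) - 1 else 0)"

definition test_content :: "nat \<Rightarrow> (nat \<Rightarrow> nat) \<Rightarrow> (nat \<Rightarrow> nat) \<Rightarrow> nat list" where
  "test_content n \<alpha> \<beta> = rev (map (\<lambda>j. rim_removed n \<alpha> j + \<beta> j) [0..<n])"

lemma sum_list_take_test_content:
  "sum_list (take (n - i) (test_content n \<alpha> \<beta>)) = sum (rim_removed n \<alpha>) {i..<n} + sum \<beta> {i..<n}"
  by (simp add: test_content_def sum_list_take_rev_map sum.distrib)

lemma rim_removed_partition: "\<alpha> \<in> partitions_upto n \<Longrightarrow> rim_removed n \<alpha> \<in> partitions_upto n"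
  by (auto simp: partitions_upto_def rim_removed_def antimono_iff_le_Suc intro: diff_le_mono)

text \<open>Positive rows make the truncated subtraction exact; \<open>n - Suc i\<close> counts the
  rows from \<open>Suc i\<close> on, each of which loses one box.\<close>

lemma sum_rim_removed:
  assumes "\<And>i. i < n \<Longrightarrow> 0 < \<alpha> i" "i < n"
  shows "sum (rim_removed n \<alpha>) {i..<n} + (n - Suc i) = sum \<alpha> {Suc i..<n}"
proof -
  obtain m where m: "n = Suc m" "i \<le> m" using assms(2) by (cases n) auto
  have "sum \<alpha> {Suc i..<Suc m} = (\<Sum>j\<in>{i..<m}. \<alpha> (Suc j))" by (rule sum.shift_bounds_Suc_ivl)
  also have "\<dots> = (\<Sum>j\<in>{i..<m}. rim_removed n \<alpha> j + 1)"
    using assms(1) m by (intro sum.cong) (auto simp: rim_removed_def)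
  also have "\<dots> = sum (rim_removed n \<alpha>) {i..<m} + (m - i)"
    by (simp only: sum.distrib) simp
  also have "sum (rim_removed n \<alpha>) {i..<m} = sum (rim_removed n \<alpha>) {i..<n}"
    using m by (simp add: rim_removed_def)
  finally show ?thesis using m by simp
qed

lemma list_splits_rev_map:
  "(rev (map f xs), rev (map g xs)) \<in> list_splits (rev (map (\<lambda>j. f j + g j) xs))"
proof -
  have "map2 (+) (rev (map f xs)) (rev (map g xs)) = rev (map (\<lambda>j. f j + g j) xs)"
    by (induction xs) simp_all
  thus ?thesis by (simp add: list_splits_def)
qed

lemma sum_unique_pair:
  fixes g :: "'a \<Rightarrow> 'b \<Rightarrow> int"
  assumes "finite S" "(a, b) \<in> S" "\<And>p q. (p, q) \<in> S \<Longrightarrow> g p q \<noteq> 0 \<Longrightarrow> p = a \<and> q = b"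
  shows "(\<Sum>(p, q)\<in>S. g p q) = g a b"
proof -
  have "(\<Sum>(p, q)\<in>S. g p q) = (\<Sum>(p, q)\<in>{(a, b)}. g p q)"
  proof (rule sum.mono_neutral_right)
    show "\<forall>x\<in>S - {(a, b)}. (case x of (p, q) \<Rightarrow> g p q) = 0"
    proof
      fix x assume x: "x \<in> S - {(a, b)}"
      show "(case x of (p, q) \<Rightarrow> g p q) = 0"
      proof (rule ccontr)
        assume "(case x of (p, q) \<Rightarrow> g p q) \<noteq> 0"
        hence "fst x = a \<and> snd x = b" using x by (intro assms(3)) (simp_all add: case_prod_unfold)
        thus False using x by (simp add: prod_eq_iff)
      qed
    qed
  qed (use assms(1,2) in simp_all)
  thus ?thesis by simp
qed

text \<open>The same comparison for any \<open>\<rho>\<close> that can occur, as an inequality with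
  the same correction \<open>n - Suc i\<close>, which therefore cancels later.\<close>

lemma sum_tail_le_Suc:
  assumes "\<And>i. \<mu> (Suc i) \<le> Suc (\<rho> i)"
  shows "sum \<mu> {Suc i..<n} \<le> sum \<rho> {i..<n} + (n - Suc i)"
proof (cases n)
  case (Suc m)
  have "sum \<mu> {Suc i..<Suc m} = (\<Sum>j\<in>{i..<m}. \<mu> (Suc j))" by (rule sum.shift_bounds_Suc_ivl)
  also have "\<dots> \<le> (\<Sum>j\<in>{i..<m}. \<rho> j + 1)" using assms by (intro sum_mono) simp
  also have "\<dots> = sum \<rho> {i..<m} + (m - i)"
    by (simp only: sum.distrib) simp
  also have "sum \<rho> {i..<m} \<le> sum \<rho> {i..<n}" using Suc by (intro sum_mono2) auto
  finally show ?thesis using Suc by simp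
qed simp

lemma newton_pairing_summand:
  assumes "\<alpha> \<in> partitions_upto n" "\<beta> \<in> partitions_upto n" "k > 0" "(p, q) \<in> list_splits m" "length m = n"
    and "newton (\<lambda>z. kostka n (z @ p) \<alpha>) k * kostka n q \<beta> \<noteq> 0"
  obtains \<rho> where "\<rho> \<in> partitions_upto n" "\<And>i. \<alpha> (Suc i) \<le> Suc (\<rho> i)"
    "\<And>i. sum \<rho> {i..<n} \<le> sum_list (take (n - i) p)" "\<And>i. sum \<beta> {i..<n} \<le> sum_list (take (n - i) q)"
proof -
  have l: "length p = n" "length q = n" using list_splits_length[OF assms(4)] assms(5) by simp_all
  have nz: "newton (\<lambda>z. kostka n (z @ p) \<alpha>) k \<noteq> 0" "kostka n q \<beta> \<noteq> 0" using assms(6) by simp_all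
  obtain \<rho> where \<rho>: "\<rho> \<in> partitions_upto n" "kostka n p \<rho> \<noteq> 0" "\<And>i. \<alpha> (Suc i) \<le> Suc (\<rho> i)"
    using newton_kostka_nonzero[OF assms(1,3) nz(1)] by blast
  show ?thesis
    using that[OF \<rho>(1,3)] kostka_tail_sums[OF \<rho>(1,2)] kostka_tail_sums[OF assms(2) nz(2)] l by simp
qed

text \<open>The tail sums see row \<open>i\<close> of \<open>\<beta>'\<close> together with only the
  rows of \<open>\<alpha>'\<close> below \<open>i\<close>. Once the rows below agree, they bound
  \<open>\<beta>' i\<close> from above, \<open>least\<close> bounds it from below, and row
  \<open>i\<close> of \<open>\<alpha>'\<close> follows from the common sum.\<close>

lemma newton_pairing_unique:
  assumes P: "\<alpha> \<in> partitions_upto n" "\<beta> \<in> partitions_upto n" "\<alpha>' \<in> partitions_upto n" "\<beta>' \<in> partitions_upto n"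
    and eq: "\<And>i. \<alpha>' i + \<beta>' i = \<alpha> i + \<beta> i"
    and pos: "\<And>i. i < n \<Longrightarrow> 0 < \<alpha> i"
    and least: "\<And>i. i < n \<Longrightarrow> (\<And>j. i < j \<Longrightarrow> j < n \<Longrightarrow> \<beta>' j = \<beta> j) \<Longrightarrow> \<beta> i \<le> \<beta>' i"
    and k: "k > 0" and nz: "newton_pairing n k (test_content n \<alpha> \<beta>) \<alpha>' \<beta>' \<noteq> 0"
  shows "\<alpha>' = \<alpha>" "\<beta>' = \<beta>"
proof -
  let ?m = "test_content n \<alpha> \<beta>"
  have len: "length ?m = n" by (simp add: test_content_def)
  from nz obtain p q where pq: "(p, q) \<in> list_splits ?m"
    and nz': "newton (\<lambda>z. kostka n (z @ p) \<alpha>') k * kostka n q \<beta>' \<noteq> 0"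
    unfolding newton_pairing_def by (elim sum.not_neutral_contains_not_neutral) auto
  obtain \<rho> where \<rho>: "\<And>i. \<alpha>' (Suc i) \<le> Suc (\<rho> i)"
    "\<And>i. sum \<rho> {i..<n} \<le> sum_list (take (n - i) p)" "\<And>i. sum \<beta>' {i..<n} \<le> sum_list (take (n - i) q)"
    using newton_pairing_summand[OF P(3,4) k pq len nz'] by metis
  \<comment> \<open>Tail sums of \<open>p\<close> and \<open>q\<close> dominate those of
    \<open>\<rho>\<close> and \<open>\<beta>'\<close> and add up to those of the test content; for
    \<open>\<alpha>\<close> itself the rim estimate is an equality.\<close>
  have le: "sum \<alpha>' {Suc i..<n} + sum \<beta>' {i..<n} \<le> sum \<alpha> {Suc i..<n} + sum \<beta> {i..<n}" if "i < n" for i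
  proof -
    have "sum \<alpha>' {Suc i..<n} + sum \<beta>' {i..<n}
        \<le> sum_list (take (n - i) p) + (n - Suc i) + sum_list (take (n - i) q)"
      using sum_tail_le_Suc[of \<alpha>' \<rho> i n] \<rho> by (meson add_mono le_trans order_refl)
    also have "\<dots> = sum_list (take (n - i) ?m) + (n - Suc i)"
      using list_splits_sum_list_take[OF pq, of "n - i"] by simp
    also have "\<dots> = sum \<alpha> {Suc i..<n} + sum \<beta> {i..<n}"
      using sum_rim_removed[OF pos that] by (simp add: sum_list_take_test_content)
    finally show ?thesis .
  qed
  have tail: "\<forall>j. n - t \<le> j \<and> j < n \<longrightarrow> \<beta>' j = \<beta> j" for t
  proof (induction t)
    case (Suc t)
    show ?case
    proof (cases "t < n")
      case True
      define i where "i = n - Suc t"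
      have i: "i < n" "Suc i = n - t" using True by (simp_all add: i_def)
      have b: "\<beta>' j = \<beta> j" if "Suc i \<le> j" "j < n" for j using Suc that i(2) by simp
      hence a: "\<alpha>' j = \<alpha> j" if "Suc i \<le> j" "j < n" for j using eq[of j] that by simp
      have "sum \<alpha>' {Suc i..<n} = sum \<alpha> {Suc i..<n}" "sum \<beta>' {Suc i..<n} = sum \<beta> {Suc i..<n}"
        using a b by (auto intro!: sum.cong)
      hence "\<beta>' i \<le> \<beta> i" using le[OF i(1)] i(1) by (simp add: sum.atLeast_Suc_lessThan)
      moreover have "\<beta> i \<le> \<beta>' i" using least[OF i(1)] b by simp
      ultimately have "\<beta>' i = \<beta> i" by simp
      thus ?thesis using b i_def by (metis le_neq_implies_less Suc_leI)
    next
      case False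
      thus ?thesis using Suc by simp
    qed
  qed simp
  show \<beta>: "\<beta>' = \<beta>"
  proof
    fix j show "\<beta>' j = \<beta> j" using tail[of n] P(2,4) by (cases "j < n") (auto simp: partitions_upto_def)
  qed
  show "\<alpha>' = \<alpha>" using eq unfolding \<beta> by (simp add: fun_eq_iff)
qed

text \<open>Tail sums force \<open>p\<close>, \<open>q\<close> and \<open>\<rho>\<close>; two
  vertical strips remain, and their contributions cancel up to a unit.\<close>

lemma newton_pairing_diagonal:
  assumes P: "\<alpha> \<in> partitions_upto n" "\<beta> \<in> partitions_upto n" and n: "n > 0"
    and pos: "\<And>i. i < n \<Longrightarrow> 0 < \<alpha> i"
  obtains k where "k > 0" "newton_pairing n k (test_content n \<alpha> \<beta>) \<alpha> \<beta> \<in> {1, -1}"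
proof -
  let ?m = "test_content n \<alpha> \<beta>" and ?r = "rim_removed n \<alpha>" and ?z = "\<lambda>\<mu> :: nat \<Rightarrow> nat. sum \<mu> {..<n}"
  let ?p = "rev (map ?r [0..<n])" and ?q = "rev (map \<beta> [0..<n])"
  note rP = rim_removed_partition[OF P(1)]
  have am: "\<alpha> (Suc i) \<le> \<alpha> i" for i using P(1) by (simp add: partitions_upto_def antimono_iff_le_Suc)
  have r_le: "?r i \<le> \<alpha> i" for i using am[of i] by (auto simp: rim_removed_def)
  have "?z ?r < ?z \<alpha>"
  proof (rule sum_strict_mono_ex1)
    show "\<exists>i\<in>{..<n}. ?r i < \<alpha> i"
      using n pos[of "n - 1"] by (intro bexI[of _ "n - 1"]) (auto simp: rim_removed_def)
  qed (use r_le in auto)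
  \<comment> \<open>\<open>k\<close> is the size of the full rim, which contains at least the last
    row of \<open>\<alpha>\<close>.\<close>
  then obtain k where k: "k > 0" "?z \<alpha> = ?z ?r + k" by (metis less_imp_add_positive)
  have len: "length ?m = n" by (simp add: test_content_def)
  have r_below: "?r i \<le> \<rho> i" if "\<And>i. \<alpha> (Suc i) \<le> Suc (\<rho> i)" for \<rho> i
    using that[of i] by (auto simp: rim_removed_def)
  have only: "p = ?p \<and> q = ?q"
    if pq: "(p, q) \<in> list_splits ?m" and nz: "newton (\<lambda>z. kostka n (z @ p) \<alpha>) k * kostka n q \<beta> \<noteq> 0" for p q
  proof -
    obtain \<rho> where \<rho>: "\<And>i. \<alpha> (Suc i) \<le> Suc (\<rho> i)"
      "\<And>i. sum \<rho> {i..<n} \<le> sum_list (take (n - i) p)" "\<And>i. sum \<beta> {i..<n} \<le> sum_list (take (n - i) q)"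
      using newton_pairing_summand[OF P k(1) pq len nz] by metis
    \<comment> \<open>Both tail sums are bounded below, and their total equals the total of the
      bounds.\<close>
    have "sum_list (take (n - i) p) = sum ?r {i..<n} \<and> sum_list (take (n - i) q) = sum \<beta> {i..<n}" for i
    proof -
      have "sum ?r {i..<n} \<le> sum \<rho> {i..<n}" using r_below[OF \<rho>(1)] by (intro sum_mono)
      thus ?thesis
        using \<rho>(2,3)[of i] list_splits_sum_list_take[OF pq, of "n - i"]
          sum_list_take_test_content[of n i \<alpha> \<beta>] by linarith
    qed
    thus ?thesis
      using list_splits_length[OF pq] len
      by (intro conjI list_eq_by_partial_sums[of _ n]) (simp_all add: sum_list_take_rev_map)
  qed
  have "(?p, ?q) \<in> list_splits ?m"
    unfolding test_content_def by (rule list_splits_rev_map)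
  hence "newton_pairing n k ?m \<alpha> \<beta> = newton (\<lambda>z. kostka n (z @ ?p) \<alpha>) k * kostka n ?q \<beta>"
    unfolding newton_pairing_def using only by (rule sum_unique_pair[OF finite_list_splits])
  also have "\<dots> = newton (\<lambda>z. kostka n (z @ ?p) \<alpha>) k" by (simp add: kostka_diagonal[OF P(2)])
  also have "\<dots> = (\<Sum>\<nu>\<in>vertical \<alpha>. (-1) ^ (?z \<alpha> + ?z \<nu>) *
      (if ?r \<in> horizontal \<nu> then int (?z \<nu>) - int (?z ?r) else 0))"
    unfolding newton_kostka[OF P(1) k(1)]
  proof (intro sum.cong refl arg_cong2[where f = "(*)"])
    fix \<nu> assume \<nu>: "\<nu> \<in> vertical \<alpha>"
    let ?R = "{\<rho> \<in> horizontal \<nu>. ?z \<alpha> = ?z \<rho> + k}"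
    have fin: "finite ?R" using finite_horizontal[OF vertical_partition[OF P(1) \<nu>]] by simp
    \<comment> \<open>Any \<open>\<rho>\<close> in question contains \<open>?r\<close> row by row,
      while the content \<open>?p\<close> leaves room for no more boxes than \<open>?r\<close>
      has.\<close>
    have zero: "kostka n ?p \<rho> = 0" if "\<rho> \<in> horizontal \<nu>" "\<rho> \<noteq> ?r" for \<rho>
    proof (rule ccontr)
      assume nz: "kostka n ?p \<rho> \<noteq> 0"
      note \<rho>P = horizontal_partition[OF vertical_partition[OF P(1) \<nu>] that(1)]
      have "\<alpha> (Suc i) \<le> Suc (\<rho> i)" for i
        using \<nu> that(1) by (auto simp: vertical_def horizontal_def intro: le_trans[OF _ Suc_le_mono[THEN iffD2]])
      note below = r_below[OF this]
      have "?z \<rho> \<le> ?z ?r"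
        using kostka_tail_sums[OF \<rho>P nz, of 0] sum_list_take_rev_map[of n 0 ?r] by (simp add: lessThan_atLeast0)
      moreover have "?z ?r \<le> ?z \<rho>" using below by (intro sum_mono)
      ultimately have "?r = \<rho>" using sum_eq_imp_eq[OF \<rho>P below] by simp
      thus False using that(2) by simp
    qed
    have "(\<Sum>\<rho>\<in>?R. (int (?z \<nu>) - int (?z \<rho>)) * kostka n ?p \<rho>)
        = (\<Sum>\<rho>\<in>?R \<inter> {?r}. (int (?z \<nu>) - int (?z \<rho>)) * kostka n ?p \<rho>)"
      using fin zero by (intro sum.mono_neutral_right) auto
    also have "?R \<inter> {?r} = (if ?r \<in> horizontal \<nu> then {?r} else {})" using k(2) by auto
    finally show "(\<Sum>\<rho>\<in>?R. (int (?z \<nu>) - int (?z \<rho>)) * kostka n ?p \<rho>)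
        = (if ?r \<in> horizontal \<nu> then int (?z \<nu>) - int (?z ?r) else 0)"
      by (simp add: kostka_diagonal[OF rP] split: if_splits)
  qed
  also have "\<dots> \<in> {1, -1}"
  proof -
    \<comment> \<open>To reach \<open>?r\<close>, the vertical strip must take a box from each
      nonempty row other than the first and may or may not take one there. The two choices have
      opposite signs and horizontal strips differing by one box, hence a sum of absolute value
      1.\<close>
    define \<nu> where "\<nu> i = \<alpha> i - 1" for i
    define \<nu>' where "\<nu>' = \<nu>(0 := \<alpha> 0)"
    have ne: "\<nu>' \<noteq> \<nu>" using pos[of 0] n by (auto simp: \<nu>'_def \<nu>_def fun_eq_iff intro!: exI[of _ 0])
    have in_v: "\<nu> \<in> vertical \<alpha>" "\<nu>' \<in> vertical \<alpha>"
      using am by (auto simp: vertical_def \<nu>_def \<nu>'_def antimono_iff_le_Suc intro: diff_le_mono le_trans[OF diff_le_self])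
    have r_eq: "?r i = \<nu> (Suc i)" for i
      using P(1) by (auto simp: rim_removed_def \<nu>_def partitions_upto_def)
    have in_h: "?r \<in> horizontal \<nu>" "?r \<in> horizontal \<nu>'"
      using in_v by (auto simp: horizontal_def r_eq \<nu>'_def vertical_def antimono_iff_le_Suc fun_upd_def)
    have only: "\<kappa> \<in> {\<nu>, \<nu>'}" if "\<kappa> \<in> vertical \<alpha>" "?r \<in> horizontal \<kappa>" for \<kappa>
    proof -
      have s: "\<kappa> (Suc i) = \<nu> (Suc i)" for i
      proof -
        have "\<kappa> (Suc i) \<le> ?r i" using that(2) by (simp add: horizontal_def)
        moreover have "\<alpha> (Suc i) \<le> Suc (\<kappa> (Suc i))" using that(1) by (simp add: vertical_def)
        ultimately show ?thesis unfolding r_eq by (simp add: \<nu>_def)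
      qed
      have "\<kappa> 0 = \<nu> 0 \<or> \<kappa> 0 = \<nu>' 0"
        using that(1) by (auto simp: vertical_def \<nu>_def \<nu>'_def le_Suc_eq intro: antisym)
      moreover have "\<nu>' (Suc i) = \<nu> (Suc i)" for i by (simp add: \<nu>'_def)
      ultimately have "(\<forall>i. \<kappa> i = \<nu> i) \<or> (\<forall>i. \<kappa> i = \<nu>' i)" using s by (metis not0_implies_Suc)
      thus ?thesis by (auto simp: fun_eq_iff)
    qed
    have z: "?z \<nu>' = Suc (?z \<nu>)"
      using n pos[of 0] by (simp add: \<nu>'_def \<nu>_def sum.remove[of "{..<n}" 0])
    have "(\<Sum>\<kappa>\<in>vertical \<alpha>. (-1) ^ (?z \<alpha> + ?z \<kappa>) * (if ?r \<in> horizontal \<kappa> then int (?z \<kappa>) - int (?z ?r) else 0))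
        = (\<Sum>\<kappa>\<in>{\<nu>, \<nu>'}. (-1) ^ (?z \<alpha> + ?z \<kappa>) * (int (?z \<kappa>) - int (?z ?r)))"
      using only in_v in_h finite_vertical[OF P(1)] by (intro sum.mono_neutral_cong_right) auto
    also have "\<dots> = - ((-1) ^ (?z \<alpha> + ?z \<nu>))"
      using ne by (simp add: z algebra_simps del: of_nat_sum)
    also have "\<dots> \<in> {1, -1 :: int}" by (cases "even (?z \<alpha> + ?z \<nu>)") simp_all
    finally show ?thesis .
  qed
  finally show ?thesis using that k(1) by blast
qed

text \<open>Tail sums of both factors are at least those of \<open>\<alpha>\<close> and add up to
  twice these, so only the diagonal decomposition contributes.\<close>

lemma kostka_square_diagonal:
  assumes P: "\<alpha> \<in> partitions_upto n"
  shows "conv (rev (map (\<lambda>i. \<alpha> i + \<alpha> i) [0..<n])) (\<lambda>l. kostka n l \<alpha>) (\<lambda>l. kostka n l \<alpha>) = 1"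
proof -
  let ?p = "rev (map \<alpha> [0..<n])" and ?m = "rev (map (\<lambda>i. \<alpha> i + \<alpha> i) [0..<n])"
  have only: "p = ?p \<and> q = ?p" if pq: "(p, q) \<in> list_splits ?m" and nz: "kostka n p \<alpha> * kostka n q \<alpha> \<noteq> 0" for p q
  proof -
    have l: "length p = n" "length q = n" using list_splits_length[OF pq] by simp_all
    have "sum_list (take (n - i) p) = sum \<alpha> {i..<n} \<and> sum_list (take (n - i) q) = sum \<alpha> {i..<n}" for i
      using kostka_tail_sums[OF P, of p i] kostka_tail_sums[OF P, of q i] nz l
        list_splits_sum_list_take[OF pq, of "n - i"] sum_list_take_rev_map[of n i "\<lambda>i. \<alpha> i + \<alpha> i"]
      by (simp add: sum.distrib)
    thus ?thesis
      using l by (intro conjI list_eq_by_partial_sums[of _ n]) (simp_all add: sum_list_take_rev_map)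
  qed
  have "(?p, ?p) \<in> list_splits ?m"
    by (rule list_splits_rev_map)
  hence "conv ?m (\<lambda>l. kostka n l \<alpha>) (\<lambda>l. kostka n l \<alpha>) = kostka n ?p \<alpha> * kostka n ?p \<alpha>"
    unfolding conv_list_splits using only by (rule sum_unique_pair[OF finite_list_splits])
  thus ?thesis by (simp add: kostka_diagonal[OF P])
qed

section \<open>An extremal pair and linear independence\<close>

text \<open>Minimise coordinate \<open>n - 1\<close> first, then recurse among the minimisers;
  finitely many coordinates suffice even for infinite \<open>S\<close>.\<close>

lemma exists_bottom_lex_least:
  fixes S :: "(nat \<Rightarrow> nat) set"
  assumes "S \<noteq> {}"
  shows "\<exists>x\<in>S. \<forall>y\<in>S. \<forall>i<n. (\<forall>j. i < j \<and> j < n \<longrightarrow> y j = x j) \<longrightarrow> x i \<le> y i"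
  using assms
proof (induction n arbitrary: S)
  case (Suc n)
  obtain z where z: "z \<in> S" "\<And>y. y \<in> S \<Longrightarrow> z n \<le> y n"
    using ex_has_least_nat[of "\<lambda>x. x \<in> S" _ "\<lambda>x. x n"] Suc.prems by blast
  have "{y \<in> S. y n = z n} \<noteq> {}" using z(1) by auto
  from Suc.IH[OF this] obtain x where x: "x \<in> S" "x n = z n"
    and least: "\<And>y i. y \<in> S \<Longrightarrow> y n = z n \<Longrightarrow> i < n \<Longrightarrow> (\<forall>j. i < j \<and> j < n \<longrightarrow> y j = x j) \<Longrightarrow> x i \<le> y i"
    by auto
  have "x i \<le> y i" if "y \<in> S" "i < Suc n" "\<forall>j. i < j \<and> j < Suc n \<longrightarrow> y j = x j" for y i
  proof (cases "i = n")
    case True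
    thus ?thesis using x z(2)[OF that(1)] by simp
  next
    case False
    thus ?thesis using least[of y i] that x(2) by auto
  qed
  thus ?case using x(1) by blast
qed auto

lemma partition_partitions_upto: "(\<And>i. n \<le> i \<Longrightarrow> part \<mu> i = 0) \<Longrightarrow> part \<mu> \<in> partitions_upto n"
  using part[of \<mu>] by (simp add: partitions_upto_def)

lemma part_plus: "part (\<alpha> + \<beta>) i = part \<alpha> i + part \<beta> i"
  by (simp add: plus_partition.rep_eq)

lemma obtain_length:
  obtains n where "part \<theta> \<in> partitions_upto n" "\<And>i. i < n \<Longrightarrow> 0 < part \<theta> i"
proof -
  have am: "antimono (part \<theta>)" and fin: "finite {i. part \<theta> i \<noteq> 0}" using part[of \<theta>] by simp_all
  have ex: "\<exists>n. part \<theta> n = 0" using fin by (metis (mono_tags) ex_new_if_finite infinite_UNIV_nat mem_Collect_eq)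
  define n where "n = (LEAST n. part \<theta> n = 0)"
  have n: "part \<theta> n = 0" unfolding n_def using ex by (rule LeastI_ex)
  have "part \<theta> i = 0" if "n \<le> i" for i using am n that by (metis antimonoD le_zero_eq)
  moreover have "0 < part \<theta> i" if "i < n" for i using not_less_Least[of i] that by (auto simp: n_def)
  ultimately show ?thesis using that partition_partitions_upto by blast
qed

text \<open>The common end of the cases of distinct and equal factors: only \<open>P\<^sub>0\<close>
  survives under \<open>L\<close>, with a unit factor. Terms with zero coefficient need no
  control.\<close>

lemma schur_combination_functional:
  fixes c :: "partition multiset \<Rightarrow> 'r::{comm_ring,comm_monoid_mult}"
  assumes L: "\<And>F G. L (F + G) = L F + (L G :: int)" and J: "finite J" "J \<subseteq> Split \<theta>"
    and zero: "(\<Sum>P\<in>J. tensor_scale (c P) (\<Prod>\<mu>\<in>#P. schur_over \<mu>)) = 0"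
    and P0: "P\<^sub>0 \<in> J" "L (\<Prod>\<mu>\<in>#P\<^sub>0. schur \<mu>) \<in> {1, -1}"
    and rest: "\<And>P. P \<in> J \<Longrightarrow> P \<noteq> P\<^sub>0 \<Longrightarrow> c P \<noteq> 0 \<Longrightarrow> L (\<Prod>\<mu>\<in>#P. schur \<mu>) = 0"
  shows "c P\<^sub>0 = 0"
proof -
  have scale_0: "int_scale z 0 = (0 :: 'r)" for z by (simp add: int_scale_def)
  have prod: "(\<Prod>\<mu>\<in>#P. schur_over \<mu>) = (pure_tensor 1 (\<Prod>\<mu>\<in>#P. schur \<mu>) :: 'r symm_fun_over)" if "P \<in> J" for P
    using that J(2) by (auto simp: Split_def schur_over_def pure_tensor_mult)
  have "(\<Sum>P\<in>J. pure_tensor (c P) (\<Prod>\<mu>\<in>#P. schur \<mu>)) = 0"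
    using zero by (simp add: prod tensor_scale_pure)
  hence "(\<Sum>P\<in>J. int_scale (L (\<Prod>\<mu>\<in>#P. schur \<mu>)) (c P)) = 0"
    using tensor_combination_functional[of L J c "\<lambda>P. \<Prod>\<mu>\<in>#P. schur \<mu>"] L J(1) by blast
  also have "(\<Sum>P\<in>J. int_scale (L (\<Prod>\<mu>\<in>#P. schur \<mu>)) (c P))
      = (\<Sum>P\<in>{P\<^sub>0}. int_scale (L (\<Prod>\<mu>\<in>#P. schur \<mu>)) (c P))"
  proof (rule sum.mono_neutral_right)
    show "\<forall>P\<in>J - {P\<^sub>0}. int_scale (L (\<Prod>\<mu>\<in>#P. schur \<mu>)) (c P) = 0"
    proof
      fix P assume P: "P \<in> J - {P\<^sub>0}"
      show "int_scale (L (\<Prod>\<mu>\<in>#P. schur \<mu>)) (c P) = 0"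
        using rest[of P] P by (cases "c P = 0") (simp_all add: scale_0)
    qed
  qed (use J P0(1) in auto)
  finally show ?thesis using P0(2) by auto
qed

theorem theorem1p2:
  fixes \<theta> :: partition
  shows "linearly_independent_family
    (tensor_scale :: 'r::{comm_ring,comm_monoid_mult} \<Rightarrow> 'r symm_fun_over \<Rightarrow> 'r symm_fun_over)
    (Split \<theta>)
    (\<lambda>P. \<Prod>\<mu>\<in>#P. schur_over \<mu>)"
  unfolding linearly_independent_family_def
proof (intro allI impI)
  fix J and c :: "partition multiset \<Rightarrow> 'r"
  assume "finite J \<and> J \<subseteq> Split \<theta> \<and> (\<Sum>P\<in>J. tensor_scale (c P) (\<Prod>\<mu>\<in>#P. schur_over \<mu>)) = 0"
  hence J: "finite J" "J \<subseteq> Split \<theta>"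
    and zero: "(\<Sum>P\<in>J. tensor_scale (c P) (\<Prod>\<mu>\<in>#P. schur_over \<mu>)) = 0" by simp_all
  obtain n where \<theta>: "part \<theta> \<in> partitions_upto n" "\<And>i. i < n \<Longrightarrow> 0 < part \<theta> i" using obtain_length[of \<theta>] by blast
  \<comment> \<open>Each unordered pair enters in both orders, matching its two Leibniz
    terms.\<close>
  define S where "S = {(\<alpha>, \<beta>). \<alpha> + \<beta> = \<theta> \<and> {#\<alpha>, \<beta>#} \<in> J \<and> c {#\<alpha>, \<beta>#} \<noteq> 0}"
  have S_swap: "(\<beta>, \<alpha>) \<in> S" if "(\<alpha>, \<beta>) \<in> S" for \<alpha> \<beta>
  proof -
    have "\<beta> + \<alpha> = \<alpha> + \<beta>" by (simp add: part_inject[symmetric] fun_eq_iff part_plus)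
    thus ?thesis using that by (simp add: S_def add_mset_commute)
  qed
  have S_sum: "part \<alpha> i + part \<beta> i = part \<theta> i" if "(\<alpha>, \<beta>) \<in> S" for \<alpha> \<beta> i
    using that by (auto simp: S_def part_plus)
  have S_upto: "part \<alpha> \<in> partitions_upto n" if "(\<alpha>, \<beta>) \<in> S" for \<alpha> \<beta>
  proof (rule partition_partitions_upto)
    fix i assume "n \<le> i"
    hence "part \<theta> i = 0" using \<theta>(1) by (simp add: partitions_upto_def)
    thus "part \<alpha> i = 0" using S_sum[OF that, of i] by simp
  qed
  have pair: "\<exists>\<alpha> \<beta>. P = {#\<alpha>, \<beta>#} \<and> (\<alpha>, \<beta>) \<in> S" if "P \<in> J" "c P \<noteq> 0" for P
  proof -
    have "P \<in> Split \<theta>" using that J(2) by blast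
    then obtain \<alpha> \<beta> where "P = {#\<alpha>, \<beta>#}" "\<alpha> + \<beta> = \<theta>" by (auto simp: Split_def)
    thus ?thesis using that by (auto simp: S_def)
  qed
  show "\<forall>P\<in>J. c P = 0"
  proof (rule ccontr)
    assume "\<not> ?thesis"
    hence "(\<lambda>x. part (snd x)) ` S \<noteq> {}" using pair by blast
    \<comment> \<open>Since \<open>S\<close> is closed under exchange, this minimum over second
      components also bounds first components.\<close>
    from exists_bottom_lex_least[OF this, of n] obtain b where b: "b \<in> (\<lambda>x. part (snd x)) ` S"
      and least: "\<forall>y\<in>(\<lambda>x. part (snd x)) ` S. \<forall>i<n. (\<forall>j. i < j \<and> j < n \<longrightarrow> y j = b j) \<longrightarrow> b i \<le> y i"
      by (rule bexE)
    from b obtain \<alpha> \<beta> where ab: "(\<alpha>, \<beta>) \<in> S" and b_def: "b = part \<beta>" by auto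
    note ba = S_swap[OF ab]
    note P = S_upto[OF ab] S_upto[OF ba]
    let ?P = "{#\<alpha>, \<beta>#}"
    have P_J: "?P \<in> J" "c ?P \<noteq> 0" using ab by (simp_all add: S_def)
    have min: "part \<beta> i \<le> part \<beta>' i"
      if "(\<alpha>', \<beta>') \<in> S" "i < n" "\<And>j. i < j \<Longrightarrow> j < n \<Longrightarrow> part \<beta>' j = part \<beta> j" for \<alpha>' \<beta>' i
    proof -
      have "part \<beta>' \<in> (\<lambda>x. part (snd x)) ` S" using that(1) by force
      from bspec[OF least this] show ?thesis using that(2,3) unfolding b_def by simp
    qed
    have "c ?P = 0"
    proof (cases "\<alpha> = \<beta>")
      case False
      \<comment> \<open>Minimality against the exchanged pair makes the last row of
        \<open>\<alpha>\<close> at least that of \<open>\<beta>\<close>, and their sum is positive.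
        So the rim of \<open>\<alpha>\<close> meets all \<open>n\<close> rows.\<close>
      have "0 < part \<alpha> (n - 1)" if "n > 0"
      proof -
        have "part \<beta> (n - 1) \<le> part \<alpha> (n - 1)" using min[OF ba, of "n - 1"] that by simp
        thus ?thesis using S_sum[OF ab, of "n - 1"] \<theta>(2)[of "n - 1"] that by simp
      qed
      hence pos: "0 < part \<alpha> i" if "i < n" for i
        using that P(1) antimonoD[of "part \<alpha>" i "n - 1"] by (force simp: partitions_upto_def)
      have n: "n > 0"
      proof (rule ccontr)
        assume "\<not> n > 0"
        hence "part \<alpha> = part \<beta>" using P by (simp add: partitions_upto_def fun_eq_iff)
        thus False using False by (simp add: part_inject)
      qed
      let ?m = "test_content n (part \<alpha>) (part \<beta>)"
      obtain k where k: "k > 0" "newton_pairing n k ?m (part \<alpha>) (part \<beta>) \<in> {1, -1}"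
        by (rule newton_pairing_diagonal[OF P n pos])
      have unique: "(\<alpha>', \<beta>') = (\<alpha>, \<beta>)"
        if "(\<alpha>', \<beta>') \<in> S" "newton_pairing n k ?m (part \<alpha>') (part \<beta>') \<noteq> 0" for \<alpha>' \<beta>'
      proof -
        have sum: "part \<alpha>' i + part \<beta>' i = part \<alpha> i + part \<beta> i" for i
          using S_sum[OF that(1)] S_sum[OF ab] by simp
        have m: "part \<beta> i \<le> part \<beta>' i" if "i < n" "\<And>j. i < j \<Longrightarrow> j < n \<Longrightarrow> part \<beta>' j = part \<beta> j" for i
          by (rule min[OF \<open>(\<alpha>', \<beta>') \<in> S\<close> that])
        note facts = P S_upto[OF that(1)] S_upto[OF S_swap[OF that(1)]] sum pos m k(1) that(2)
        have "part \<alpha>' = part \<alpha>" "part \<beta>' = part \<beta>"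
          by (rule newton_pairing_unique[of "part \<alpha>" n "part \<beta>" "part \<alpha>'" "part \<beta>'" k]; fact facts)+
        thus ?thesis by (simp add: part_inject)
      qed
      show ?thesis
      proof (rule schur_combination_functional[where L = "newton_functional k ?m", OF newton_functional_add J zero P_J(1)])
        \<comment> \<open>As \<open>\<alpha> \<noteq> \<beta>\<close>, the other Leibniz term of the
          chosen product belongs to a different ordered pair and adds nothing to the unit.\<close>
        have "newton_pairing n k ?m (part \<beta>) (part \<alpha>) = 0" using unique[OF ba] False by auto
        thus "newton_functional k ?m (\<Prod>\<mu>\<in>#?P. schur \<mu>) \<in> {1, -1}"
          using k(2) newton_functional_schur_times[OF P k(1)] by simp
        show "newton_functional k ?m (\<Prod>\<mu>\<in>#Q. schur \<mu>) = 0" if Q: "Q \<in> J" "Q \<noteq> ?P" "c Q \<noteq> 0" for Q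
        proof -
          obtain \<alpha>' \<beta>' where Q_eq: "Q = {#\<alpha>', \<beta>'#}" and o: "(\<alpha>', \<beta>') \<in> S" using pair Q by blast
          have "(\<alpha>', \<beta>') \<noteq> (\<alpha>, \<beta>)" "(\<beta>', \<alpha>') \<noteq> (\<alpha>, \<beta>)"
            using Q(2) Q_eq by (auto simp: add_mset_commute)
          hence "newton_pairing n k ?m (part \<alpha>') (part \<beta>') = 0"
            "newton_pairing n k ?m (part \<beta>') (part \<alpha>') = 0"
            using unique[OF o] unique[OF S_swap[OF o]] by blast+
          thus ?thesis
            using newton_functional_schur_times[OF S_upto[OF o] S_upto[OF S_swap[OF o]] k(1)] Q_eq by simp
        qed
      qed
    next
      case True
      \<comment> \<open>From the bottom up, minimality makes the rows of both
        \<open>\<alpha>'\<close> and \<open>\<beta>'\<close> at least those of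
        \<open>\<beta>\<close>, while their sum is twice the latter. So no other pair has a nonzero
        coefficient.\<close>
      have same: "\<beta>' = \<beta>" if o: "(\<alpha>', \<beta>') \<in> S" for \<alpha>' \<beta>'
      proof -
        have "\<forall>j. n - t \<le> j \<and> j < n \<longrightarrow> part \<beta>' j = part \<beta> j \<and> part \<alpha>' j = part \<beta> j" for t
        proof (induction t)
          case (Suc t)
          have "part \<beta>' i = part \<beta> i \<and> part \<alpha>' i = part \<beta> i" if "n - Suc t \<le> i" "i < n" for i
          proof -
            have "part \<beta> i \<le> part \<beta>' i" using min[OF o that(2)] Suc that by auto
            moreover have "part \<beta> i \<le> part \<alpha>' i" using min[OF S_swap[OF o] that(2)] Suc that by auto
            ultimately show ?thesis using S_sum[OF o, of i] S_sum[OF ab, of i] True by simp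
          qed
          thus ?case by blast
        qed simp
        from this[of n] have "part \<beta>' j = part \<beta> j" for j
          using P(2) S_upto[OF S_swap[OF o]] by (cases "j < n") (auto simp: partitions_upto_def)
        thus ?thesis by (simp add: part_inject[symmetric] fun_eq_iff)
      qed
      let ?m = "rev (map (\<lambda>i. part \<alpha> i + part \<alpha> i) [0..<n])"
      have add: "sf_coeff (F + G) (list_monomial ?m) = sf_coeff F (list_monomial ?m) + sf_coeff G (list_monomial ?m)"
        for F G by (simp add: plus_symm_fun.rep_eq)
      show ?thesis
      proof (rule schur_combination_functional[where L = "\<lambda>F. sf_coeff F (list_monomial ?m)", OF add J zero P_J(1)])
        have "sf_coeff (schur \<alpha> * schur \<alpha>) (list_monomial ?m) = 1"
          using kostka_square_diagonal[OF P(1)]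
          by (simp add: sf_coeff_times_list_monomial sf_coeff_schur_list_monomial[OF P(1)])
        thus "sf_coeff (\<Prod>\<mu>\<in>#?P. schur \<mu>) (list_monomial ?m) \<in> {1, -1}" using True by simp
        show "sf_coeff (\<Prod>\<mu>\<in>#Q. schur \<mu>) (list_monomial ?m) = 0" if Q: "Q \<in> J" "Q \<noteq> ?P" "c Q \<noteq> 0" for Q
        proof -
          obtain \<alpha>' \<beta>' where "Q = {#\<alpha>', \<beta>'#}" and o: "(\<alpha>', \<beta>') \<in> S" using pair Q by blast
          thus ?thesis using same[OF o] same[OF S_swap[OF o]] True Q(2) by simp
        qed
      qed
    qed
    thus False using P_J(2) by simp
  qed
qed

end
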